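(* Let $p=p(n)\in(0,1)$ and let $Z^{(k)}_n$ be the $k$-th order generalized Zagreb index of $G(n,p)$. As $n\to\infty$, the following assertions hold for any integer $k\ge1$. (i) If $n^2p\to 0$, then $Z^{(k)}_n\to 0$ in probability. (ii) If there exists a constant $\lambda>0$ such that $n^2 p\to\lambda$, then $Z^{(k)}_n/2$ converges in distribution to $\mathrm{Poi}(\lambda/2)$. (iii) If $n^2 p\to \infty$, then $Z^{(k)}_n/ \mathbb{E}[Z^{(k)}_n]\to 1$ in probability. (iv) If $n^2(1-p)\to 0$, then $\mathbb{P}\big(Z^{(k)}_n=n(n-1)^k\big)\to 1$. (v) If there exists a constant $\lambda>0$ such that $n^2 (1-p)\to \lambda$, then $$\frac{n(n-1)^k-Z^{(k)}_n}{2kn^{k-1}}$$ converges in distribution to $\mathrm{Poi}(\lambda/2)$. (vi) If $n^2 (1-p)\to \infty$, then $$\frac{n(n-1)^k-Z^{(k)}_n}{n^{k+1}(1-p^k)}\to 1\quad\text{in probability}.$$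
   Context: $G(n,p)$ is the Erdős–Rényi random graph on the vertex set $\{1,\dots,n\}$, in which each possible edge is present independently with probability $p$, where $0<p<1$ and $p=p(n)$ may depend on $n$. $I_{ij}$ is the indicator of the event that there is an edge between $i$ and $j$ (so $I_{ii}=0$, $I_{ij}=I_{ji}$). For an integer $k\ge1$, the $k$-th order generalized Zagreb index is $Z_n^{(k)}=\sum_{i=1}^n\big(\sum_{j=1}^n I_{ij}\big)^k$, the sum of the $k$-th powers of the vertex degrees. $\mathrm{Poi}(\mu)$ denotes the Poisson distribution with parameter $\mu>0$. *)

theory Defs
  imports "HOL-Probability.Probability"
begin

definition possible_edges :: "nat \<Rightarrow> nat set set" where
  "possible_edges n = {e. e \<subseteq> {1..n} \<and> card e = 2}"

text \<open>The random graph on \<open>{1..n}\<close> is represented by its random edge set.\<close>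

definition erdos_renyi :: "nat \<Rightarrow> real \<Rightarrow> nat set set pmf" where
  "erdos_renyi n p =
     map_pmf (\<lambda>\<omega>. {e \<in> possible_edges n. \<omega> e})
       (Pi_pmf (possible_edges n) False (\<lambda>_. bernoulli_pmf p))"

definition edge_ind :: "nat set set \<Rightarrow> nat \<Rightarrow> nat \<Rightarrow> real" where
  "edge_ind E i j = of_bool (i \<noteq> j \<and> {i, j} \<in> E)"

definition zagreb :: "nat \<Rightarrow> nat \<Rightarrow> nat set set \<Rightarrow> real" where
  "zagreb k n E = (\<Sum>i=1..n. (\<Sum>j=1..n. edge_ind E i j) ^ k)"

text \<open>Convergence in probability to a constant; the random variables may live on
  different probability spaces.\<close>

definition tendsto_in_prob ::
    "(nat \<Rightarrow> 'a measure) \<Rightarrow> (nat \<Rightarrow> 'a \<Rightarrow> real) \<Rightarrow> real \<Rightarrow> bool" where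
  "tendsto_in_prob M X c \<longleftrightarrow>
     (\<forall>\<epsilon>>0. (\<lambda>n. measure (M n) {x \<in> space (M n). \<bar>X n x - c\<bar> > \<epsilon>}) \<longlonglongrightarrow> 0)"

definition tendsto_in_distr ::
    "(nat \<Rightarrow> 'a measure) \<Rightarrow> (nat \<Rightarrow> 'a \<Rightarrow> real) \<Rightarrow> real measure \<Rightarrow> bool" where
  "tendsto_in_distr M X N \<longleftrightarrow> weak_conv_m (\<lambda>n. distr (M n) borel (X n)) N"

definition Poi :: "real \<Rightarrow> real measure" where
  "Poi \<mu> = distr (measure_pmf (poisson_pmf \<mu>)) borel real"

end

theory Submission
  imports Defs "HOL-Real_Asymp.Real_Asymp"
begin

text \<open>
  The edge indicators are independent Bernoulli variables, so the Efron--Stein inequality controls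
  the variance of the Zagreb index: toggling one edge changes the sum of the \<open>k\<close>-th powers of
  the degrees \<open>d\<close> only at its two endpoints, by at most \<open>k (1 + d) ^ (k - 1)\<close> each. Together
  with the moments of the binomial distribution this makes the variance negligible against the
  square of the mean as soon as \<open>n\<^sup>2 p\<close> (or \<open>n\<^sup>2 (1 - p)\<close>, for the deficit) tends to infinity,
  and the laws of large numbers follow from Chebyshev's inequality. If instead
  \<open>n\<^sup>2 p\<close> stays bounded, then with high probability no two edges are adjacent, so all degrees
  are 0 or 1 and the index is twice the number of edges, whose characteristic function
  \<open>(1 + p (exp (\<i> t) - 1)) ^ m\<close> converges to that of a Poisson variable. The dense case
  is the same with missing edges in place of edges.
\<close>

section \<open>Products of Bernoulli distributions\<close>

text \<open>The graph is the image of a product of Bernoulli variables indexed by possible edges, so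
  each claim is pulled back to that product and concerns only numbers of coordinates with a given
  value. Its support is finite, hence every function on it is integrable.

  The two laws of large numbers meet different obstacles. For the index itself the mean may be far
  below \<open>n ^ (k + 1)\<close>, so bounding degrees by \<open>n\<close> would lose too much:
  degree moments are needed on the scale \<open>1 + n p\<close>, with constants that do not depend
  on \<open>p\<close>. For the deficit the normalisation contains the full power
  \<open>n ^ (k + 1)\<close> and the trivial degree bound is enough. This normalisation is not the
  exact mean, however, and it contains \<open>1 - p ^ k\<close>, which may tend to 0; the bias must
  therefore be bounded by a multiple of \<open>1 - p\<close>, so that an error of order
  \<open>1 / n\<close> is left after division.\<close>

abbreviation bernoulli_prod :: "'a set \<Rightarrow> real \<Rightarrow> ('a \<Rightarrow> bool) pmf" where
  "bernoulli_prod A p \<equiv> Pi_pmf A False (\<lambda>_. bernoulli_pmf p)"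

lemma finite_set_bernoulli_prod [simp]:
  assumes "finite A"
  shows "finite (set_pmf (bernoulli_prod A p))"
  unfolding set_Pi_pmf[OF assms] using assms by (intro finite_PiE_dflt) (auto intro: finite_subset)

lemma integrable_bernoulli_prod [simp]:
  fixes f :: "('a \<Rightarrow> bool) \<Rightarrow> 'b::{banach, second_countable_topology}"
  assumes "finite A"
  shows "integrable (measure_pmf (bernoulli_prod A p)) f"
  by (intro integrable_measure_pmf_finite finite_set_bernoulli_prod assms)

text \<open>Conditioning on a single coordinate; both inductions over the index set run on this
  recursion.\<close>

lemma expectation_bernoulli_prod_insert:
  fixes f :: "('a \<Rightarrow> bool) \<Rightarrow> 'b::{banach, second_countable_topology}"
  assumes "finite A" "a \<notin> A" "p \<in> {0..1}"
  shows "measure_pmf.expectation (bernoulli_prod (insert a A) p) f =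
    p *\<^sub>R measure_pmf.expectation (bernoulli_prod A p) (\<lambda>w. f (w(a := True))) +
    (1 - p) *\<^sub>R measure_pmf.expectation (bernoulli_prod A p) (\<lambda>w. f (w(a := False)))"
proof -
  have eq: "bernoulli_prod (insert a A) p =
      bernoulli_pmf p \<bind> (\<lambda>y. map_pmf (\<lambda>w. w(a := y)) (bernoulli_prod A p))"
    using assms by (simp add: Pi_pmf_insert' map_pmf_def)
  show ?thesis
    unfolding eq using assms
    by (subst pmf_expectation_bind[where A = UNIV]) (auto simp: UNIV_bool)
qed

text \<open>A two-valued variable taking its values with probabilities \<open>p\<close> and
  \<open>1 - p\<close> has variance \<open>p (1 - p)\<close> times the squared difference of the
  values, so each summand is the mean conditional variance in one coordinate. The induction is the
  law of total variance for the inserted coordinate.\<close>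

lemma Efron_Stein_bernoulli_prod:
  fixes f :: "('a \<Rightarrow> bool) \<Rightarrow> real"
  assumes "finite A" and p: "p \<in> {0..1}"
  shows "measure_pmf.variance (bernoulli_prod A p) f \<le>
    p * (1 - p) * (\<Sum>e\<in>A. measure_pmf.expectation (bernoulli_prod A p)
                     (\<lambda>w. (f (w(e := True)) - f (w(e := False)))\<^sup>2))"
  using assms(1)
proof (induction A arbitrary: f rule: finite_induct)
  case empty
  then show ?case by simp
next
  case (insert a A)
  let ?E = "measure_pmf.expectation (bernoulli_prod A p)"
  let ?V = "measure_pmf.variance (bernoulli_prod A p)"
  let ?E' = "measure_pmf.expectation (bernoulli_prod (insert a A) p)"
  define f1 where "f1 w = f (w(a := True))" for w
  define f0 where "f0 w = f (w(a := False))" for w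
  note E' = expectation_bernoulli_prod_insert[OF insert.hyps p]
  have V: "?V g = ?E (\<lambda>w. (g w)\<^sup>2) - (?E g)\<^sup>2" for g :: "_ \<Rightarrow> real"
    using insert.hyps by (intro measure_pmf.variance_eq) auto
  \<comment> \<open>Jensen's inequality for the square, read off from the nonnegativity of a
    variance.\<close>
  have "(?E (\<lambda>w. f1 w - f0 w))\<^sup>2 \<le> ?E (\<lambda>w. (f1 w - f0 w)\<^sup>2)"
    using V[of "\<lambda>w. f1 w - f0 w"] measure_pmf.variance_positive[of "bernoulli_prod A p" "\<lambda>w. f1 w - f0 w"]
    by linarith
  then have diff: "(?E f1 - ?E f0)\<^sup>2 \<le> ?E (\<lambda>w. (f1 w - f0 w)\<^sup>2)"
    using insert.hyps by simp
  have "measure_pmf.variance (bernoulli_prod (insert a A) p) f = ?E' (\<lambda>w. (f w)\<^sup>2) - (?E' f)\<^sup>2"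
    using insert.hyps by (intro measure_pmf.variance_eq) auto
  also have "\<dots> = p * ?E (\<lambda>w. (f1 w)\<^sup>2) + (1 - p) * ?E (\<lambda>w. (f0 w)\<^sup>2)
      - (p * ?E f1 + (1 - p) * ?E f0)\<^sup>2"
    unfolding E' f1_def f0_def by simp
  \<comment> \<open>Mean conditional variance plus variance of the conditional mean.\<close>
  also have "\<dots> = p * ?V f1 + (1 - p) * ?V f0 + p * (1 - p) * (?E f1 - ?E f0)\<^sup>2"
    unfolding V by (simp add: power2_eq_square algebra_simps)
  also have "\<dots> \<le> p * (p * (1 - p) * (\<Sum>e\<in>A. ?E (\<lambda>w. (f1 (w(e := True)) - f1 (w(e := False)))\<^sup>2)))
      + (1 - p) * (p * (1 - p) * (\<Sum>e\<in>A. ?E (\<lambda>w. (f0 (w(e := True)) - f0 (w(e := False)))\<^sup>2)))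
      + p * (1 - p) * ?E (\<lambda>w. (f1 w - f0 w)\<^sup>2)"
    using p by (intro add_mono mult_left_mono insert.IH diff) auto
  also have "\<dots> = p * (1 - p) * ((\<Sum>e\<in>A. p * ?E (\<lambda>w. (f1 (w(e := True)) - f1 (w(e := False)))\<^sup>2)
      + (1 - p) * ?E (\<lambda>w. (f0 (w(e := True)) - f0 (w(e := False)))\<^sup>2))
      + ?E (\<lambda>w. (f1 w - f0 w)\<^sup>2))"
    by (simp only: sum.distrib flip: sum_distrib_left) (simp add: algebra_simps)
  also have "(\<Sum>e\<in>A. p * ?E (\<lambda>w. (f1 (w(e := True)) - f1 (w(e := False)))\<^sup>2)
      + (1 - p) * ?E (\<lambda>w. (f0 (w(e := True)) - f0 (w(e := False)))\<^sup>2)) =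
      (\<Sum>e\<in>A. ?E' (\<lambda>w. (f (w(e := True)) - f (w(e := False)))\<^sup>2))"
  proof (intro sum.cong refl)
    fix e assume "e \<in> A"
    then have "w(a := b, e := b') = w(e := b', a := b)" for w :: "'a \<Rightarrow> bool" and b b'
      using insert.hyps by (intro fun_upd_twist) auto
    then show "p * ?E (\<lambda>w. (f1 (w(e := True)) - f1 (w(e := False)))\<^sup>2)
        + (1 - p) * ?E (\<lambda>w. (f0 (w(e := True)) - f0 (w(e := False)))\<^sup>2) =
        ?E' (\<lambda>w. (f (w(e := True)) - f (w(e := False)))\<^sup>2)"
      unfolding E' f1_def f0_def by simp
  qed
  also have "?E (\<lambda>w. (f1 w - f0 w)\<^sup>2) = ?E' (\<lambda>w. (f (w(a := True)) - f (w(a := False)))\<^sup>2)"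
    unfolding E' f1_def f0_def by (simp add: algebra_simps)
  finally show ?case
    unfolding sum.insert[OF insert.hyps] by (simp only: add.commute)
qed

text \<open>The generating function of a binomial variable. The field is left open because
  \<open>u\<close> is a real exponential in the moment bound and a complex number of modulus 1 in
  the Poisson limit.\<close>

lemma expectation_power_card_bernoulli_prod:
  fixes u :: "'b::{real_normed_field, banach, second_countable_topology}"
  assumes "finite A" and p: "p \<in> {0..1}" and "S \<subseteq> A"
  shows "measure_pmf.expectation (bernoulli_prod A p) (\<lambda>w. u ^ card {e \<in> S. w e = c}) =
    (1 + of_real (if c then p else 1 - p) * (u - 1)) ^ card S"
  using assms(1,3)
proof (induction A arbitrary: S rule: finite_induct)
  case empty
  then show ?case by simp
next
  case (insert a A)
  let ?E = "measure_pmf.expectation (bernoulli_prod A p)"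
  let ?S = "S - {a}"
  have fin: "finite S" "finite ?S" "?S \<subseteq> A"
    using insert by (auto intro: finite_subset)
  define m where "m = card ?S"
  note IH = insert.IH[OF fin(3), folded m_def]
  have upd: "card {e \<in> S. (w(a := b)) e = c} =
      (if a \<in> S \<and> b = c then 1 else 0) + card {e \<in> ?S. w e = c}" for w b
  proof -
    have "{e \<in> S. (w(a := b)) e = c} =
        (if a \<in> S \<and> b = c then {a} else {}) \<union> {e \<in> ?S. w e = c}" by auto
    then show ?thesis using fin by auto
  qed
  have S: "card S = (if a \<in> S then 1 else 0) + m"
  proof (cases "a \<in> S")
    case True
    then show ?thesis
      unfolding m_def using card_Suc_Diff1[OF fin(1) True] by (simp only: if_True)
  qed (simp add: m_def)
  have pow: "v ^ card S = (if a \<in> S then v else 1) * v ^ m" for v :: 'b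
    unfolding S by simp
  have pow': "u ^ card {e \<in> S. (w(a := b)) e = c} =
      (if a \<in> S \<and> b = c then u else 1) * u ^ card {e \<in> ?S. w e = c}" for w b
    unfolding upd by simp
  show ?case
    unfolding expectation_bernoulli_prod_insert[OF insert.hyps p] pow pow' integral_mult_right_zero IH
    by (cases c; cases "a \<in> S"; simp add: scaleR_conv_of_real algebra_simps)
qed

section \<open>Expectation tools for finitely supported distributions\<close>

lemma expectation_mono_finite:
  fixes f g :: "'a \<Rightarrow> real"
  assumes "finite (set_pmf M)" "\<And>x. x \<in> set_pmf M \<Longrightarrow> f x \<le> g x"
  shows "measure_pmf.expectation M f \<le> measure_pmf.expectation M g"
  using assms by (intro integral_mono_AE) (auto simp: AE_measure_pmf_iff intro: integrable_measure_pmf_finite)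

text \<open>Markov's inequality with a free majorant of the indicator: later a count
  \<open>N\<close>, then \<open>N ^ 2 - N\<close>, and a scaled squared deviation.\<close>

lemma prob_le_expectation_finite:
  fixes f :: "'a \<Rightarrow> real"
  assumes "finite (set_pmf M)" "\<And>x. x \<in> set_pmf M \<Longrightarrow> 0 \<le> f x"
    "\<And>x. x \<in> set_pmf M \<Longrightarrow> x \<in> B \<Longrightarrow> 1 \<le> f x"
  shows "measure_pmf.prob M B \<le> measure_pmf.expectation M f"
proof -
  have "measure_pmf.prob M B = measure_pmf.expectation M (indicator B)" by simp
  also have "\<dots> \<le> measure_pmf.expectation M f"
    using assms by (intro expectation_mono_finite) (auto simp: indicator_def)
  finally show ?thesis .
qed

lemma variance_eq_finite:
  fixes f :: "'a \<Rightarrow> real"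
  assumes "finite (set_pmf M)"
  shows "measure_pmf.variance M f = measure_pmf.expectation M (\<lambda>x. (f x)\<^sup>2) - (measure_pmf.expectation M f)\<^sup>2"
  using assms by (intro measure_pmf.variance_eq integrable_measure_pmf_finite)

text \<open>Bias-variance decomposition, needed because the normalised deficit is compared with 1,
  which need not be its mean.\<close>

lemma expectation_square_dist_finite:
  fixes f :: "'a \<Rightarrow> real"
  assumes "finite (set_pmf M)"
  shows "measure_pmf.expectation M (\<lambda>x. (f x - c)\<^sup>2) =
    measure_pmf.variance M f + (measure_pmf.expectation M f - c)\<^sup>2"
proof -
  have [simp]: "integrable (measure_pmf M) g" for g :: "'a \<Rightarrow> real"
    using assms by (rule integrable_measure_pmf_finite)
  show ?thesis
    unfolding variance_eq_finite[OF assms] by (simp add: power2_diff)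
qed

lemma tendsto_in_prob_L2:
  assumes fin: "\<And>n. finite (set_pmf (M n))"
    and "(\<lambda>n. measure_pmf.expectation (M n) (\<lambda>x. (X n x - c)\<^sup>2)) \<longlonglongrightarrow> 0"
  shows "tendsto_in_prob (\<lambda>n. measure_pmf (M n)) X c"
  unfolding tendsto_in_prob_def
proof (intro allI impI)
  fix \<epsilon> :: real assume \<epsilon>: "\<epsilon> > 0"
  show "(\<lambda>n. measure_pmf.prob (M n) {x \<in> space (measure_pmf (M n)). \<bar>X n x - c\<bar> > \<epsilon>}) \<longlonglongrightarrow> 0"
  proof (rule tendsto_sandwich[OF always_eventually always_eventually tendsto_const])
    show "\<forall>n. measure_pmf.prob (M n) {x \<in> space (measure_pmf (M n)). \<bar>X n x - c\<bar> > \<epsilon>} \<le>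
        measure_pmf.expectation (M n) (\<lambda>x. (X n x - c)\<^sup>2) / \<epsilon>\<^sup>2"
    proof
      fix n
      have "1 \<le> (X n x - c)\<^sup>2 / \<epsilon>\<^sup>2" if "\<bar>X n x - c\<bar> > \<epsilon>" for x
        using power_mono[of \<epsilon> "\<bar>X n x - c\<bar>" 2] that \<epsilon> by simp
      then have "measure_pmf.prob (M n) {x \<in> space (measure_pmf (M n)). \<bar>X n x - c\<bar> > \<epsilon>} \<le>
          measure_pmf.expectation (M n) (\<lambda>x. (X n x - c)\<^sup>2 / \<epsilon>\<^sup>2)"
        by (intro prob_le_expectation_finite fin) auto
      then show "measure_pmf.prob (M n) {x \<in> space (measure_pmf (M n)). \<bar>X n x - c\<bar> > \<epsilon>} \<le>
          measure_pmf.expectation (M n) (\<lambda>x. (X n x - c)\<^sup>2) / \<epsilon>\<^sup>2" by simp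
    qed
    show "(\<lambda>n. measure_pmf.expectation (M n) (\<lambda>x. (X n x - c)\<^sup>2) / \<epsilon>\<^sup>2) \<longlonglongrightarrow> 0"
      using tendsto_divide[OF assms(2) tendsto_const, of "\<epsilon>\<^sup>2"] \<epsilon> by simp
  qed simp
qed

section \<open>Moments and tails of the number of coordinates with a given value\<close>

lemma expectation_card_bernoulli_prod:
  assumes A: "finite A" and p: "p \<in> {0..1}" and "S \<subseteq> A"
  shows "measure_pmf.expectation (bernoulli_prod A p) (\<lambda>w. real (card {e \<in> S. w e = c})) =
    (if c then p else 1 - p) * card S"
proof -
  have S: "finite S" using assms finite_subset by blast
  have single: "measure_pmf.expectation (bernoulli_prod A p) (\<lambda>w. of_bool (w e = c) :: real) =
      (if c then p else 1 - p)" if "e \<in> S" for e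
  proof -
    have "measure_pmf.expectation (bernoulli_prod A p) (\<lambda>w. of_bool (w e = c) :: real) =
        measure_pmf.expectation (map_pmf (\<lambda>w. w e) (bernoulli_prod A p)) (\<lambda>b. of_bool (b = c) :: real)"
      by simp
    also have "map_pmf (\<lambda>w. w e) (bernoulli_prod A p) = bernoulli_pmf p"
      using that assms by (subst Pi_pmf_component) auto
    finally show ?thesis using p by (cases c) auto
  qed
  have "real (card {e \<in> S. w e = c}) = (\<Sum>e\<in>S. of_bool (w e = c))" for w
    using S by (simp add: sum.If_cases Int_def of_bool_def)
  then show ?thesis
    using A single by simp
qed

text \<open>Toggling a coordinate changes the count by exactly one if it lies in \<open>S\<close>
  and not at all otherwise, so Efron-Stein gives the binomial variance without computing
  covariances.\<close>

lemma variance_card_bernoulli_prod_le: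
  assumes A: "finite A" and p: "p \<in> {0..1}" and S: "S \<subseteq> A"
  shows "measure_pmf.variance (bernoulli_prod A p) (\<lambda>w. real (card {e \<in> S. w e = c})) \<le>
    p * (1 - p) * card S"
proof -
  have S': "finite S" using assms finite_subset by blast
  have "(real (card {x \<in> S. (w(e := True)) x = c}) - real (card {x \<in> S. (w(e := False)) x = c}))\<^sup>2
      = of_bool (e \<in> S)" for w e
  proof (cases "e \<in> S")
    case True
    have "{x \<in> S. (w(e := b)) x = c} = (if b = c then {e} else {}) \<union> {x \<in> S - {e}. w x = c}" for b
      using True by auto
    then have "card {x \<in> S. (w(e := b)) x = c} = (if b = c then 1 else 0) + card {x \<in> S - {e}. w x = c}"
      for b using S' by auto
    then show ?thesis using True by (cases c) auto
  next
    case False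
    then have "{x \<in> S. (w(e := b)) x = c} = {x \<in> S. w x = c}" for b by auto
    then show ?thesis using False by simp
  qed
  then have "measure_pmf.variance (bernoulli_prod A p) (\<lambda>w. real (card {e \<in> S. w e = c})) \<le>
      p * (1 - p) * (\<Sum>e\<in>A. of_bool (e \<in> S))"
    using Efron_Stein_bernoulli_prod[OF A p, of "\<lambda>w. real (card {e \<in> S. w e = c})"] by simp
  also have "(\<Sum>e\<in>A. of_bool (e \<in> S)) = real (card S)"
    using A S by (simp add: of_bool_def sum.If_cases Int_absorb1)
  finally show ?thesis .
qed

lemma prob_card_pos_bernoulli_prod_le:
  assumes A: "finite A" and p: "p \<in> {0..1}" and S: "S \<subseteq> A"
  shows "measure_pmf.prob (bernoulli_prod A p) {w. card {e \<in> S. w e = c} \<noteq> 0} \<le>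
    (if c then p else 1 - p) * card S"
  unfolding expectation_card_bernoulli_prod[OF assms, of c, symmetric]
  using A by (intro prob_le_expectation_finite) auto

text \<open>For integers, \<open>N ^ 2 - N\<close> is nonnegative and at least 1 once
  \<open>N >= 2\<close>. Its mean is the variance plus the squared mean minus the mean.\<close>

lemma prob_card_ge_2_bernoulli_prod_le:
  assumes A: "finite A" and p: "p \<in> {0..1}" and S: "S \<subseteq> A"
  shows "measure_pmf.prob (bernoulli_prod A p) {w. card {e \<in> S. w e = c} \<ge> 2} \<le>
    ((if c then p else 1 - p) * card S)\<^sup>2"
proof -
  let ?E = "measure_pmf.expectation (bernoulli_prod A p)"
  let ?N = "\<lambda>w. real (card {e \<in> S. w e = c})"
  have quad: "0 \<le> (real m)\<^sup>2 - m \<and> (m \<ge> 2 \<longrightarrow> 1 \<le> (real m)\<^sup>2 - m)" for m :: nat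
  proof (cases "m \<ge> 2")
    case True
    then have "real m * 2 \<le> real m * real m" by (intro mult_left_mono) auto
    moreover have "real m \<ge> 2" using True by simp
    ultimately show ?thesis unfolding power2_eq_square by linarith
  next
    case False
    then have "m = 0 \<or> m = 1" by auto
    then show ?thesis by auto
  qed
  have "measure_pmf.prob (bernoulli_prod A p) {w. card {e \<in> S. w e = c} \<ge> 2} \<le>
      ?E (\<lambda>w. (?N w)\<^sup>2 - ?N w)"
    using A quad by (intro prob_le_expectation_finite) auto
  also have "\<dots> = ?E (\<lambda>w. (?N w)\<^sup>2) - ?E ?N"
    using A by simp
  also have "?E (\<lambda>w. (?N w)\<^sup>2) = measure_pmf.variance (bernoulli_prod A p) ?N + (?E ?N)\<^sup>2"
    using A by (subst variance_eq_finite) auto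
  also have "\<dots> \<le> p * (1 - p) * card S + (?E ?N)\<^sup>2"
    using variance_card_bernoulli_prod_le[OF assms] by simp
  \<comment> \<open>The variance is at most the mean, so it is absorbed by the subtracted mean and
    only the squared mean survives.\<close>
  also have "p * (1 - p) * card S \<le> (if c then p else 1 - p) * card S"
    using p by (intro mult_right_mono) (auto simp: mult_left_le mult_left_le_one_le)
  finally show ?thesis
    unfolding expectation_card_bernoulli_prod[OF assms] by simp
qed

lemma power_le_fact_exp:
  fixes x :: real
  assumes "x \<ge> 0"
  shows "x ^ j \<le> fact j * exp x"
proof -
  have "(\<Sum>i\<in>{j}. x ^ i /\<^sub>R fact i) \<le> exp x"
    unfolding exp_def using assms by (intro sum_le_suminf summable_exp_generic) auto
  then show ?thesis by (simp add: field_simps)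
qed

text \<open>The comparison \<open>y ^ j \<le> j! * exp y\<close> is applied at \<open>y = (1 + N) / s\<close>,
  where the scale \<open>s = 1 + p |S|\<close> keeps the moment generating function bounded.\<close>

lemma moment_card_bernoulli_prod_le:
  assumes A: "finite A" and p: "p \<in> {0..1}" and S: "S \<subseteq> A"
  shows "measure_pmf.expectation (bernoulli_prod A p) (\<lambda>w. (1 + real (card {e \<in> S. w e})) ^ j) \<le>
    fact j * exp 3 * (1 + p * card S) ^ j"
proof -
  let ?E = "measure_pmf.expectation (bernoulli_prod A p)"
  define s where "s = 1 + p * card S"
  have s: "s \<ge> 1" "s > 0" using p by (auto simp: s_def intro: add_pos_nonneg)
  have "?E (\<lambda>w. (1 + real (card {e \<in> S. w e})) ^ j) \<le>
      ?E (\<lambda>w. (fact j * s ^ j * exp (1 / s)) * exp (1 / s) ^ card {e \<in> S. w e = True})"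
  proof (rule expectation_mono_finite)
    fix w
    let ?y = "1 + real (card {e \<in> S. w e})"
    have "(?y / s) ^ j \<le> fact j * exp (?y / s)"
      using s by (intro power_le_fact_exp) auto
    also have "exp (?y / s) = exp (1 / s) * exp (1 / s) ^ card {e \<in> S. w e}"
      by (simp add: add_divide_distrib exp_add flip: exp_of_nat_mult)
    finally show "?y ^ j \<le> (fact j * s ^ j * exp (1 / s)) * exp (1 / s) ^ card {e \<in> S. w e = True}"
      using s by (simp add: power_divide field_simps)
  qed (use A in simp)
  also have "\<dots> = fact j * s ^ j * (exp (1 / s) * (1 + p * (exp (1 / s) - 1)) ^ card S)"
    using expectation_power_card_bernoulli_prod[OF A p S, of "exp (1 / s)" True] by simp
  also have "\<dots> \<le> fact j * s ^ j * (exp 1 * exp 2)"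
  proof (intro mult_left_mono mult_mono)
    show "exp (1 / s) \<le> exp 1" using s by simp
    \<comment> \<open>Since \<open>1 / s <= 1\<close>, this yields
      \<open>exp (1 / s) - 1 <= 2 / s\<close>. As \<open>p |S| <= s\<close>, the power is at most
      \<open>exp 2\<close>; the remaining factor \<open>exp 1\<close> of \<open>exp 3\<close> comes
      from the 1 in \<open>1 + N\<close>.\<close>
    have "exp (1 / s) \<le> 1 + 1 / s + (1 / s)\<^sup>2"
      using s by (intro exp_bound) auto
    moreover have "(1 / s)\<^sup>2 \<le> 1 / s"
      using s by (simp add: power2_eq_square field_simps)
    ultimately have "p * (exp (1 / s) - 1) \<le> p * (2 / s)"
      using p by (intro mult_left_mono) auto
    then have "1 + p * (exp (1 / s) - 1) \<le> exp (p * (2 / s))"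
      using exp_ge_add_one_self[of "p * (2 / s)"] by linarith
    then have "(1 + p * (exp (1 / s) - 1)) ^ card S \<le> exp (p * (2 / s)) ^ card S"
      using p s by (intro power_mono) (auto intro!: add_nonneg_nonneg mult_nonneg_nonneg)
    also have "\<dots> = exp (p * card S / s * 2)"
      by (simp flip: exp_of_nat_mult)
    also have "p * card S / s * 2 \<le> 1 * 2"
      using s by (intro mult_right_mono) (simp_all add: s_def)
    then have "exp (p * card S / s * 2) \<le> exp 2" by simp
    finally show "(1 + p * (exp (1 / s) - 1)) ^ card S \<le> exp 2" .
  qed (use p s in auto)
  also have "exp 1 * exp 2 = exp (3 :: real)"
    by (simp flip: exp_add)
  finally show ?thesis by (simp add: s_def mult_ac)
qed

section \<open>Vertex degrees\<close>

definition incident_edges :: "nat \<Rightarrow> nat \<Rightarrow> nat set set" where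
  "incident_edges n i = {e \<in> possible_edges n. i \<in> e}"

text \<open>For \<open>c = False\<close> this is the degree in the complement graph. Keeping
  \<open>c\<close> as a parameter lets the sparse and the dense case share their estimates.\<close>

abbreviation edge_degree :: "bool \<Rightarrow> nat \<Rightarrow> (nat set \<Rightarrow> bool) \<Rightarrow> nat \<Rightarrow> nat" where
  "edge_degree c n w i \<equiv> card {e \<in> incident_edges n i. w e = c}"

lemma finite_possible_edges [simp]: "finite (possible_edges n)"
  by (rule finite_subset[of _ "Pow {1..n}"]) (auto simp: possible_edges_def)

lemma card_possible_edges: "real (card (possible_edges n)) = real n * (real n - 1) / 2"
proof -
  have "real (n choose 2) = real n * (real n - 1) / 2"
    by (induction n) (auto simp: numeral_2_eq_2 field_simps)
  then show ?thesis
    using n_subsets[of "{1..n}" 2] by (simp add: possible_edges_def)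
qed

lemma card_possible_edges_le: "real (card (possible_edges n)) \<le> (real n)\<^sup>2 / 2"
  unfolding card_possible_edges by (simp add: power2_eq_square mult_left_mono)

lemma incident_edges_subset: "incident_edges n i \<subseteq> possible_edges n"
  by (auto simp: incident_edges_def)

lemma finite_incident_edges [simp]: "finite (incident_edges n i)"
  using incident_edges_subset by (rule finite_subset) simp

lemma possible_edge_at:
  assumes "e \<in> possible_edges n" "i \<in> e"
  obtains j where "j \<in> {1..n}" "i \<noteq> j" "e = {i, j}"
proof -
  from assms obtain x y where e: "e = {x, y}" "x \<noteq> y" "{x, y} \<subseteq> {1..n}"
    by (auto simp: possible_edges_def card_2_iff)
  then have "i = x \<or> i = y" using assms by auto
  then show thesis using that[of x] that[of y] e by auto
qed

text \<open>Translates between sums over neighbours, as in \<open>zagreb\<close>, and counts of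
  edges, which are the independent coordinates.\<close>

lemma card_edges_at:
  assumes "E \<subseteq> possible_edges n"
  shows "card {e \<in> E. i \<in> e} = card {j \<in> {1..n}. i \<noteq> j \<and> {i, j} \<in> E}"
proof -
  have "{e \<in> E. i \<in> e} = (\<lambda>j. {i, j}) ` {j \<in> {1..n}. i \<noteq> j \<and> {i, j} \<in> E}"
  proof (intro equalityI subsetI)
    fix e assume e: "e \<in> {e \<in> E. i \<in> e}"
    then have "e \<in> possible_edges n" "i \<in> e" using assms by auto
    then obtain j where "j \<in> {1..n}" "i \<noteq> j" "e = {i, j}"
      by (rule possible_edge_at)
    with e show "e \<in> (\<lambda>j. {i, j}) ` {j \<in> {1..n}. i \<noteq> j \<and> {i, j} \<in> E}" by blast
  qed auto
  moreover have "inj_on (\<lambda>j. {i, j}) {j \<in> {1..n}. i \<noteq> j \<and> {i, j} \<in> E}"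
    by (auto simp: inj_on_def doubleton_eq_iff)
  ultimately show ?thesis by (simp add: card_image)
qed

lemma card_incident_edges:
  assumes "i \<in> {1..n}"
  shows "card (incident_edges n i) = n - 1"
proof -
  have "{j \<in> {1..n}. i \<noteq> j \<and> {i, j} \<in> possible_edges n} = {1..n} - {i}"
    using assms by (auto simp: possible_edges_def card_2_iff doubleton_eq_iff)
  then show ?thesis
    using card_edges_at[of "possible_edges n" n i] assms by (simp add: incident_edges_def)
qed

lemma edge_degree_le:
  assumes "i \<in> {1..n}"
  shows "edge_degree c n w i \<le> n - 1"
  unfolding card_incident_edges[OF assms, symmetric] by (intro card_mono) auto

lemma edge_degree_complement:
  assumes "i \<in> {1..n}"
  shows "real (edge_degree True n w i) = real (n - 1) - real (edge_degree False n w i)"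
proof -
  have "n - 1 = card ({e \<in> incident_edges n i. w e = True} \<union> {e \<in> incident_edges n i. w e = False})"
    unfolding card_incident_edges[OF assms, symmetric] by (intro arg_cong[of _ _ card]) auto
  also have "\<dots> = edge_degree True n w i + edge_degree False n w i"
    by (intro card_Un_disjoint) auto
  finally show ?thesis by simp
qed

text \<open>The handshake lemma, by counting incidences of vertices and edges in two ways.\<close>

lemma sum_edge_degree:
  "(\<Sum>i=1..n. edge_degree c n w i) = 2 * card {e \<in> possible_edges n. w e = c}"
proof -
  let ?E = "{e \<in> possible_edges n. w e = c}"
  have "edge_degree c n w i = (\<Sum>e\<in>?E. of_bool (i \<in> e))" for i
    by (auto simp: incident_edges_def of_bool_def sum.If_cases intro!: arg_cong[of _ _ card])
  then have "(\<Sum>i=1..n. edge_degree c n w i) = (\<Sum>e\<in>?E. \<Sum>i=1..n. of_bool (i \<in> e))"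
    by (simp only:) (rule sum.swap)
  also have "\<dots> = (\<Sum>e\<in>?E. 2)"
  proof (intro sum.cong refl)
    fix e assume "e \<in> ?E"
    then have "{i \<in> {1..n}. i \<in> e} = e" "card e = 2" by (auto simp: possible_edges_def)
    then show "(\<Sum>i=1..n. of_bool (i \<in> e)) = (2::nat)"
      by (simp add: of_bool_def sum.If_cases Int_def)
  qed
  finally show ?thesis by simp
qed

lemma zagreb_eq_sum_edge_degree:
  "zagreb k n {e \<in> possible_edges n. w e} = (\<Sum>i=1..n. real (edge_degree True n w i) ^ k)"
proof -
  have "(\<Sum>j=1..n. edge_ind {e \<in> possible_edges n. w e} i j) = real (edge_degree True n w i)" for i
  proof -
    have "edge_degree True n w i = card {e \<in> {e \<in> possible_edges n. w e}. i \<in> e}"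
      by (intro arg_cong[of _ _ card]) (auto simp: incident_edges_def)
    also have "\<dots> = card {j \<in> {1..n}. i \<noteq> j \<and> {i, j} \<in> {e \<in> possible_edges n. w e}}"
      by (intro card_edges_at) auto
    finally show ?thesis
      by (simp add: edge_ind_def of_bool_def sum.If_cases Int_def)
  qed
  then show ?thesis by (simp add: zagreb_def)
qed

text \<open>Union bound over the vertices. If \<open>n ^ 2 r\<close> stays bounded, where
  \<open>r\<close> is \<open>p\<close> or \<open>1 - p\<close> according to \<open>c\<close>, the
  right-hand side \<open>(n ^ 2 r) ^ 2 / n\<close> vanishes, so adjacent edges disappear.\<close>

lemma prob_edge_degree_ge_2_le:
  assumes p: "p \<in> {0..1}"
  shows "measure_pmf.prob (bernoulli_prod (possible_edges n) p) {w. \<exists>i\<in>{1..n}. edge_degree c n w i \<ge> 2} \<le>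
    real n ^ 3 * (if c then p else 1 - p)\<^sup>2"
proof -
  let ?r = "if c then p else 1 - p"
  have "{w. \<exists>i\<in>{1..n}. edge_degree c n w i \<ge> 2} = (\<Union>i\<in>{1..n}. {w. edge_degree c n w i \<ge> 2})"
    by auto
  then have "measure_pmf.prob (bernoulli_prod (possible_edges n) p) {w. \<exists>i\<in>{1..n}. edge_degree c n w i \<ge> 2} \<le>
      (\<Sum>i=1..n. measure_pmf.prob (bernoulli_prod (possible_edges n) p) {w. edge_degree c n w i \<ge> 2})"
    by (simp only:) (intro measure_pmf.finite_measure_subadditive_finite, auto)
  also have "\<dots> \<le> (\<Sum>i=1..n. (?r * n)\<^sup>2)"
  proof (intro sum_mono)
    fix i assume i: "i \<in> {1..n}"
    have "measure_pmf.prob (bernoulli_prod (possible_edges n) p) {w. edge_degree c n w i \<ge> 2} \<le>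
        (?r * card (incident_edges n i))\<^sup>2"
      using p by (intro prob_card_ge_2_bernoulli_prod_le incident_edges_subset) auto
    also have "\<dots> \<le> (?r * n)\<^sup>2"
      using p i by (intro power_mono mult_left_mono) (auto simp: card_incident_edges)
    finally show "measure_pmf.prob (bernoulli_prod (possible_edges n) p) {w. edge_degree c n w i \<ge> 2} \<le> (?r * n)\<^sup>2" .
  qed
  also have "\<dots> = real n ^ 3 * ?r\<^sup>2"
    by (simp add: power_mult_distrib power3_eq_cube power2_eq_square)
  finally show ?thesis .
qed

section \<open>Efron-Stein bound for the sum of degree powers\<close>

lemma power_Suc_diff_le:
  fixes x :: real
  assumes "x \<ge> 0"
  shows "(x + 1) ^ k - x ^ k \<le> k * (1 + x) ^ (k - 1)"
proof (induction k)
  case (Suc k)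
  have "(x + 1) ^ Suc k - x ^ Suc k = (x + 1) ^ k + x * ((x + 1) ^ k - x ^ k)"
    by (simp add: algebra_simps)
  also have "\<dots> \<le> (x + 1) ^ k + x * (k * (1 + x) ^ (k - 1))"
    using Suc assms by (intro add_left_mono mult_left_mono) auto
  also have "\<dots> \<le> (x + 1) ^ k + (1 + x) * (k * (1 + x) ^ (k - 1))"
    using assms by (intro add_left_mono mult_right_mono) auto
  \<comment> \<open>The case \<open>k = 0\<close> is split off because \<open>k - 1\<close> is
    truncated there; the factor \<open>k\<close> makes the term vanish anyway.\<close>
  also have "\<dots> = Suc k * (1 + x) ^ (Suc k - 1)"
    by (cases k) (auto simp: algebra_simps)
  finally show ?case .
qed simp

text \<open>The factor 2 is Cauchy-Schwarz over the two endpoints. The right-hand side uses the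
  degree in \<open>w\<close> itself, which is at least the degree without \<open>e\<close>, so that
  averaging produces a plain degree moment.\<close>

lemma sum_edge_degree_power_diff_sq_le:
  assumes e: "e \<in> possible_edges n"
  shows "((\<Sum>i=1..n. real (edge_degree True n (w(e := True)) i) ^ k) -
      (\<Sum>i=1..n. real (edge_degree True n (w(e := False)) i) ^ k))\<^sup>2 \<le>
    2 * (real k)\<^sup>2 * (\<Sum>i\<in>e. (1 + real (edge_degree True n w i)) ^ (2 * (k - 1)))"
proof -
  let ?d = "\<lambda>w i. real (edge_degree True n w i)"
  have e': "e \<subseteq> {1..n}" "card e = 2" "finite e"
    using e by (auto simp: possible_edges_def intro: finite_subset)
  have "(\<Sum>i=1..n. ?d (w(e := True)) i ^ k) - (\<Sum>i=1..n. ?d (w(e := False)) i ^ k)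
      = (\<Sum>i=1..n. ?d (w(e := True)) i ^ k - ?d (w(e := False)) i ^ k)"
    by (simp add: sum_subtractf)
  also have "\<dots> = (\<Sum>i\<in>e. ?d (w(e := True)) i ^ k - ?d (w(e := False)) i ^ k)"
  proof (rule sum.mono_neutral_right)
    show "\<forall>i\<in>{1..n} - e. ?d (w(e := True)) i ^ k - ?d (w(e := False)) i ^ k = 0"
    proof
      fix i assume "i \<in> {1..n} - e"
      then have "{x \<in> incident_edges n i. (w(e := b)) x = True} = {x \<in> incident_edges n i. w x = True}" for b
        by (auto simp: incident_edges_def)
      then show "?d (w(e := True)) i ^ k - ?d (w(e := False)) i ^ k = 0"
        by (simp only: diff_self)
    qed
  qed (use e' in auto)
  finally have eq: "(\<Sum>i=1..n. ?d (w(e := True)) i ^ k) - (\<Sum>i=1..n. ?d (w(e := False)) i ^ k)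
      = (\<Sum>i\<in>e. ?d (w(e := True)) i ^ k - ?d (w(e := False)) i ^ k)" .
  have vertex: "(?d (w(e := True)) i ^ k - ?d (w(e := False)) i ^ k)\<^sup>2 \<le>
      (real k)\<^sup>2 * (1 + ?d w i) ^ (2 * (k - 1))" if "i \<in> e" for i
  proof -
    let ?x = "card {x \<in> incident_edges n i - {e}. w x}"
    have "e \<in> incident_edges n i" using that e by (simp add: incident_edges_def)
    then have "{x \<in> incident_edges n i. (w(e := b)) x = True} =
        (if b then {e} else {}) \<union> {x \<in> incident_edges n i - {e}. w x}" for b
      by auto
    then have d: "?d (w(e := b)) i = (if b then 1 else 0) + real ?x" for b
      by (simp only:) (subst card_Un_disjoint, auto)
    have "(?d (w(e := True)) i ^ k - ?d (w(e := False)) i ^ k)\<^sup>2 = ((real ?x + 1) ^ k - real ?x ^ k)\<^sup>2"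
      unfolding d by (simp add: add.commute)
    also have "\<dots> \<le> (k * (1 + real ?x) ^ (k - 1))\<^sup>2"
      by (intro power_mono power_Suc_diff_le) (auto intro!: power_mono)
    also have "\<dots> \<le> (k * (1 + ?d w i) ^ (k - 1))\<^sup>2"
      by (intro power_mono mult_left_mono add_left_mono) (auto intro!: card_mono)
    also have "\<dots> = (real k)\<^sup>2 * (1 + ?d w i) ^ (2 * (k - 1))"
      by (simp only: power_mult_distrib power_mult[symmetric] mult.commute)
    finally show ?thesis .
  qed
  have "(\<Sum>i\<in>e. ?d (w(e := True)) i ^ k - ?d (w(e := False)) i ^ k)\<^sup>2 \<le>
      2 * (\<Sum>i\<in>e. (?d (w(e := True)) i ^ k - ?d (w(e := False)) i ^ k)\<^sup>2)"
    using sum_squared_le_sum_of_squares[of _ e] unfolding e' by (simp only: of_nat_numeral mult.commute)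
  also have "\<dots> \<le> 2 * (\<Sum>i\<in>e. (real k)\<^sup>2 * (1 + ?d w i) ^ (2 * (k - 1)))"
    using vertex by (intro mult_left_mono sum_mono) auto
  finally show ?thesis
    unfolding eq by (simp add: sum_distrib_left mult.assoc)
qed

text \<open>The moment bound \<open>B\<close> is left abstract since it is chosen in two ways: on
  the scale \<open>1 + n p\<close> for the index, and as \<open>n ^ (2 * (k - 1))\<close> for the
  deficit.\<close>

lemma variance_sum_edge_degree_power_le:
  assumes p: "p \<in> {0..1}"
    and B: "\<And>i. i \<in> {1..n} \<Longrightarrow> measure_pmf.expectation (bernoulli_prod (possible_edges n) p)
        (\<lambda>w. (1 + real (edge_degree True n w i)) ^ (2 * (k - 1))) \<le> B"
    and "B \<ge> 0"
  shows "measure_pmf.variance (bernoulli_prod (possible_edges n) p)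
      (\<lambda>w. \<Sum>i=1..n. real (edge_degree True n w i) ^ k) \<le> 2 * (real k)\<^sup>2 * (real n)\<^sup>2 * (p * (1 - p)) * B"
proof -
  let ?E = "measure_pmf.expectation (bernoulli_prod (possible_edges n) p)"
  let ?f = "\<lambda>w. \<Sum>i=1..n. real (edge_degree True n w i) ^ k"
  have edge: "?E (\<lambda>w. (?f (w(e := True)) - ?f (w(e := False)))\<^sup>2) \<le> 4 * (real k)\<^sup>2 * B"
    if e: "e \<in> possible_edges n" for e
  proof -
    have e': "e \<subseteq> {1..n}" "card e = 2"
      using e by (auto simp: possible_edges_def)
    have "?E (\<lambda>w. (?f (w(e := True)) - ?f (w(e := False)))\<^sup>2) \<le>
        ?E (\<lambda>w. 2 * (real k)\<^sup>2 * (\<Sum>i\<in>e. (1 + real (edge_degree True n w i)) ^ (2 * (k - 1))))"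
      using sum_edge_degree_power_diff_sq_le[OF e] by (intro expectation_mono_finite) auto
    also have "\<dots> = 2 * (real k)\<^sup>2 * (\<Sum>i\<in>e. ?E (\<lambda>w. (1 + real (edge_degree True n w i)) ^ (2 * (k - 1))))"
      by simp
    also have "\<dots> \<le> 2 * (real k)\<^sup>2 * (\<Sum>i\<in>e. B)"
      using e' by (intro mult_left_mono sum_mono B) auto
    finally show ?thesis using e' by simp
  qed
  have "measure_pmf.variance (bernoulli_prod (possible_edges n) p) ?f \<le>
      p * (1 - p) * (\<Sum>e\<in>possible_edges n. ?E (\<lambda>w. (?f (w(e := True)) - ?f (w(e := False)))\<^sup>2))"
    using p by (intro Efron_Stein_bernoulli_prod) auto
  also have "\<dots> \<le> p * (1 - p) * (\<Sum>e\<in>possible_edges n. 4 * (real k)\<^sup>2 * B)"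
    using p by (intro mult_left_mono sum_mono edge) auto
  also have "\<dots> = real (card (possible_edges n)) * (p * (1 - p) * (4 * (real k)\<^sup>2 * B))"
    by simp
  also have "\<dots> \<le> (real n)\<^sup>2 / 2 * (p * (1 - p) * (4 * (real k)\<^sup>2 * B))"
    using p \<open>B \<ge> 0\<close> card_possible_edges_le by (intro mult_right_mono) auto
  finally show ?thesis by (simp add: algebra_simps)
qed

section \<open>Poisson limits\<close>

lemma char_Poi:
  assumes "\<mu> > 0"
  shows "char (Poi \<mu>) t = exp (\<mu> * (iexp t - 1))"
proof -
  let ?f = "\<lambda>j :: nat. of_real (pmf (poisson_pmf \<mu>) j) * iexp (t * real j)"
  have "char (Poi \<mu>) t = measure_pmf.expectation (poisson_pmf \<mu>) (\<lambda>j. iexp (t * real j))"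
    unfolding Poi_def char_def by (subst integral_distr) auto
  also have "\<dots> = (LINT j|count_space UNIV. ?f j)"
    unfolding measure_pmf_eq_density
    by (subst integral_density) (auto simp: scaleR_conv_of_real)
  finally have eq: "char (Poi \<mu>) t = (LINT j|count_space UNIV. ?f j)" .
  have "integrable (count_space UNIV) (\<lambda>j. pmf (poisson_pmf \<mu>) j)"
    by (rule integrable_pmf)
  then have "integrable (count_space UNIV) ?f"
    by (rule Bochner_Integration.integrable_bound) (auto simp: norm_mult)
  then have "?f sums char (Poi \<mu>) t"
    unfolding eq by (rule sums_integral_count_space_nat)
  moreover have "?f sums (exp (of_real \<mu> * iexp t) * exp (- of_real \<mu>))"
  proof -
    have "(\<lambda>j. (of_real \<mu> * iexp t) ^ j /\<^sub>R fact j * exp (- of_real \<mu>)) sums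
        (exp (of_real \<mu> * iexp t) * exp (- of_real \<mu>))"
      by (intro sums_mult2 exp_converges)
    moreover have "(of_real \<mu> * iexp t) ^ j /\<^sub>R fact j * exp (- of_real \<mu>) = ?f j" for j
      using assms
      by (simp add: scaleR_conv_of_real power_mult_distrib exp_of_real[symmetric] field_simps
               flip: exp_of_nat_mult)
    ultimately show ?thesis by simp
  qed
  ultimately have "char (Poi \<mu>) t = exp (of_real \<mu> * iexp t) * exp (- of_real \<mu>)"
    by (rule sums_unique2)
  then show ?thesis
    by (simp add: algebra_simps flip: exp_add)
qed

lemma tendsto_in_distr_Poi:
  assumes "\<mu> > 0"
    and "\<And>t. (\<lambda>n. measure_pmf.expectation (M n) (\<lambda>x. iexp (t * X n x))) \<longlonglongrightarrow> exp (\<mu> * (iexp t - 1))"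
  shows "tendsto_in_distr (\<lambda>n. measure_pmf (M n)) X (Poi \<mu>)"
  unfolding tendsto_in_distr_def
proof (rule levy_continuity)
  show "real_distribution (distr (measure_pmf (M n)) borel (X n))" for n
    by (intro prob_space.real_distribution_distr prob_space_measure_pmf) auto
  show "real_distribution (Poi \<mu>)"
    unfolding Poi_def by (intro prob_space.real_distribution_distr prob_space_measure_pmf) auto
  have "char (distr (measure_pmf (M n)) borel (X n)) t =
      measure_pmf.expectation (M n) (\<lambda>x. iexp (t * X n x))" for n t
    unfolding char_def by (subst integral_distr) auto
  then show "(\<lambda>n. char (distr (measure_pmf (M n)) borel (X n)) t) \<longlonglongrightarrow> char (Poi \<mu>) t" for t
    using assms by (simp add: char_Poi)
qed

text \<open>With \<open>w = r (z - 1)\<close>, both \<open>1 + w\<close> and \<open>exp w\<close>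
  lie in the closed unit disc, so their \<open>m\<close>-th powers differ by at most
  \<open>m\<close> times their distance. That distance is of order \<open>r ^ 2\<close>, and
  \<open>m r ^ 2\<close> tends to 0. The base \<open>z\<close> varies with \<open>n\<close> to
  accommodate the factors \<open>a n\<close> below.\<close>

lemma tendsto_one_plus_power_Poisson:
  fixes z :: "nat \<Rightarrow> complex" and r :: "nat \<Rightarrow> real" and m :: "nat \<Rightarrow> nat"
  assumes z: "\<And>n. norm (z n) \<le> 1" "z \<longlonglongrightarrow> l"
    and r: "eventually (\<lambda>n. r n \<in> {0..1}) sequentially" "r \<longlonglongrightarrow> 0"
    and m: "(\<lambda>n. m n * r n) \<longlonglongrightarrow> \<mu>"
  shows "(\<lambda>n. (1 + r n * (z n - 1)) ^ m n) \<longlonglongrightarrow> exp (\<mu> * (l - 1))"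
proof -
  have "(\<lambda>n. exp (of_real (m n * r n) * (z n - 1))) \<longlonglongrightarrow> exp (of_real \<mu> * (l - 1))"
    using z(2) m by (intro tendsto_intros)
  moreover have "(\<lambda>n. (1 + r n * (z n - 1)) ^ m n - exp (of_real (m n * r n) * (z n - 1))) \<longlonglongrightarrow> 0"
  proof (rule tendsto_0_le[where K = 1])
    have "(\<lambda>n. (m n * r n) * (4 * r n * exp (2 * r n))) \<longlonglongrightarrow> \<mu> * (4 * 0 * exp (2 * 0))"
      by (intro tendsto_intros r m)
    then show "(\<lambda>n. (m n * r n) * (4 * r n * exp (2 * r n))) \<longlonglongrightarrow> 0" by simp
    show "eventually (\<lambda>n. norm ((1 + r n * (z n - 1)) ^ m n - exp (of_real (m n * r n) * (z n - 1)))
        \<le> norm ((m n * r n) * (4 * r n * exp (2 * r n))) * 1) sequentially"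
      using r(1)
    proof eventually_elim
      case (elim n)
      define w where "w = of_real (r n) * (z n - 1)"
      have "norm (z n - 1) \<le> 2"
        using norm_triangle_ineq4[of "z n" 1] z(1)[of n] by simp
      then have w: "norm w \<le> 2 * r n"
        using elim by (simp add: w_def norm_mult mult.commute[of 2] mult_left_mono)
      \<comment> \<open>A convex combination of 1 and \<open>z n\<close>, hence of modulus at most
        1.\<close>
      have "1 + w = of_real (1 - r n) + of_real (r n) * z n"
        by (simp add: w_def algebra_simps)
      also have "norm \<dots> \<le> (1 - r n) + r n * norm (z n)"
      proof -
        have "norm (complex_of_real (1 - r n)) = 1 - r n"
          using elim unfolding norm_of_real by simp
        then show ?thesis
          using norm_triangle_ineq[of "complex_of_real (1 - r n)" "of_real (r n) * z n"] elim
          by (simp add: norm_mult del: of_real_diff)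
      qed
      also have "\<dots> \<le> 1"
        using elim z(1)[of n] by (simp add: mult_left_le)
      finally have n1: "norm (1 + w) \<le> 1" .
      have "Re w \<le> 0"
        using elim z(1)[of n] complex_Re_le_cmod[of "z n"]
        by (auto simp: w_def intro!: mult_nonneg_nonpos)
      then have n2: "norm (exp w) \<le> 1" by simp
      have "norm (1 + w - exp w) = norm (exp w - (\<Sum>j\<le>1. w ^ j / fact j))"
        by (simp add: norm_minus_commute)
      also have "\<dots> \<le> exp \<bar>Re w\<bar> * norm w ^ Suc 1 / fact 1"
        by (rule Taylor_exp)
      also have "\<dots> \<le> exp (2 * r n) * (2 * r n) ^ 2"
      proof -
        have "norm w ^ Suc 1 \<le> (2 * r n) ^ 2"
          unfolding Suc_1 using w by (intro power_mono) auto
        moreover have "exp \<bar>Re w\<bar> \<le> exp (2 * r n)"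
          using w abs_Re_le_cmod[of w] by simp
        ultimately have "exp \<bar>Re w\<bar> * norm w ^ Suc 1 \<le> exp (2 * r n) * (2 * r n) ^ 2"
          by (intro mult_mono) auto
        then show ?thesis by simp
      qed
      finally have "norm (1 + w - exp w) \<le> 4 * (r n)\<^sup>2 * exp (2 * r n)"
        by (simp add: power_mult_distrib mult_ac)
      then have "m n * norm (1 + w - exp w) \<le> m n * (4 * (r n)\<^sup>2 * exp (2 * r n))"
        by (intro mult_left_mono) auto
      with norm_power_diff[OF n1 n2, of "m n"]
      have "norm ((1 + w) ^ m n - exp w ^ m n) \<le> (m n * r n) * (4 * r n * exp (2 * r n))"
        by (simp add: power2_eq_square mult_ac)
      also have "exp w ^ m n = exp (of_real (m n * r n) * (z n - 1))"
        by (simp add: w_def mult_ac flip: exp_of_nat_mult)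
      finally show ?case by (simp add: w_def)
    qed
  qed
  ultimately show ?thesis
    using tendsto_add by fastforce
qed

lemma norm_iexp_diff_le: "norm (iexp x - iexp y) \<le> 2 * of_bool (x \<noteq> y)"
  using norm_triangle_ineq4[of "iexp x" "iexp y"] by simp

text \<open>The factors \<open>a n\<close> allow for the normalisation of the Zagreb index, which is only
  asymptotically equal to the increment caused by deleting one edge.\<close>

lemma tendsto_in_distr_Poi_card:
  fixes A :: "nat \<Rightarrow> 'a set" and X :: "nat \<Rightarrow> ('a \<Rightarrow> bool) \<Rightarrow> real" and p r a :: "nat \<Rightarrow> real" and c :: bool
  defines "r \<equiv> \<lambda>n. if c then p n else 1 - p n"
  assumes A: "\<And>n. finite (A n)" and p: "eventually (\<lambda>n. p n \<in> {0..1}) sequentially"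
    and r: "r \<longlonglongrightarrow> 0" and \<mu>: "(\<lambda>n. card (A n) * r n) \<longlonglongrightarrow> \<mu>" "\<mu> > 0"
    and a: "a \<longlonglongrightarrow> 1"
    and X: "(\<lambda>n. measure_pmf.prob (bernoulli_prod (A n) (p n))
        {w. X n w \<noteq> a n * card {e \<in> A n. w e = c}}) \<longlonglongrightarrow> 0"
  shows "tendsto_in_distr (\<lambda>n. measure_pmf (bernoulli_prod (A n) (p n))) X (Poi \<mu>)"
proof (rule tendsto_in_distr_Poi[OF \<mu>(2)])
  fix t :: real
  let ?E = "\<lambda>n. measure_pmf.expectation (bernoulli_prod (A n) (p n)) :: _ \<Rightarrow> complex"
  let ?N = "\<lambda>n w. a n * card {e \<in> A n. w e = c}"
  have "(\<lambda>n. (1 + r n * (iexp (t * a n) - 1)) ^ card (A n)) \<longlonglongrightarrow> exp (\<mu> * (iexp t - 1))"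
  proof (rule tendsto_one_plus_power_Poisson)
    have "(\<lambda>n. iexp (t * a n)) \<longlonglongrightarrow> iexp (t * 1)"
      by (intro tendsto_intros a)
    then show "(\<lambda>n. iexp (t * a n)) \<longlonglongrightarrow> iexp t" by simp
    show "eventually (\<lambda>n. r n \<in> {0..1}) sequentially"
      using p by eventually_elim (auto simp: r_def)
  qed (use r \<mu> in auto)
  moreover have "eventually (\<lambda>n. (1 + r n * (iexp (t * a n) - 1)) ^ card (A n) =
      ?E n (\<lambda>w. iexp (t * ?N n w))) sequentially"
    using p
  proof eventually_elim
    case (elim n)
    have "?E n (\<lambda>w. iexp (t * ?N n w)) = ?E n (\<lambda>w. iexp (t * a n) ^ card {e \<in> A n. w e = c})"
      by (simp add: mult_ac flip: exp_of_nat_mult)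
    also have "\<dots> = (1 + r n * (iexp (t * a n) - 1)) ^ card (A n)"
      using elim A by (subst expectation_power_card_bernoulli_prod) (auto simp: r_def)
    finally show ?case by simp
  qed
  ultimately have "(\<lambda>n. ?E n (\<lambda>w. iexp (t * ?N n w))) \<longlonglongrightarrow> exp (\<mu> * (iexp t - 1))"
    by (rule Lim_transform_eventually)
  \<comment> \<open>Values of \<open>iexp\<close> have modulus 1, so replacing \<open>X\<close> by
    the scaled count costs at most twice the probability that they differ.\<close>
  moreover have "(\<lambda>n. ?E n (\<lambda>w. iexp (t * X n w)) - ?E n (\<lambda>w. iexp (t * ?N n w))) \<longlonglongrightarrow> 0"
  proof (rule tendsto_0_le[OF X, where K = 2], rule always_eventually, rule allI)
    fix n
    have "norm (?E n (\<lambda>w. iexp (t * X n w)) - ?E n (\<lambda>w. iexp (t * ?N n w))) =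
        norm (?E n (\<lambda>w. iexp (t * X n w) - iexp (t * ?N n w)))"
      using A by (subst Bochner_Integration.integral_diff) auto
    also have "\<dots> \<le> measure_pmf.expectation (bernoulli_prod (A n) (p n))
        (\<lambda>w. norm (iexp (t * X n w) - iexp (t * ?N n w)))"
      by (rule integral_norm_bound)
    also have "\<dots> \<le> measure_pmf.expectation (bernoulli_prod (A n) (p n))
        (\<lambda>w. 2 * indicator {w. X n w \<noteq> ?N n w} w)"
    proof (intro expectation_mono_finite)
      fix w
      show "norm (iexp (t * X n w) - iexp (t * ?N n w)) \<le> 2 * indicator {w. X n w \<noteq> ?N n w} w"
        using norm_iexp_diff_le[of "t * X n w" "t * ?N n w"]
        by (cases "X n w = ?N n w") (auto elim: order_trans)
    qed (use A in simp)
    also have "\<dots> = 2 * measure_pmf.prob (bernoulli_prod (A n) (p n)) {w. X n w \<noteq> ?N n w}"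
      by simp
    finally show "norm (?E n (\<lambda>w. iexp (t * X n w)) - ?E n (\<lambda>w. iexp (t * ?N n w))) \<le>
        norm (measure_pmf.prob (bernoulli_prod (A n) (p n)) {w. X n w \<noteq> ?N n w}) * 2"
      by simp
  qed
  ultimately show "(\<lambda>n. ?E n (\<lambda>w. iexp (t * X n w))) \<longlonglongrightarrow> exp (\<mu> * (iexp t - 1))"
    using tendsto_add by fastforce
qed

section \<open>Mean and variance of the sum of degree powers\<close>

text \<open>A recursion for the remainder of \<open>x ^ k\<close> over its tangent at
  \<open>y\<close>. The added term is a nonnegative multiple of \<open>(x - y) ^ 2\<close> for
  \<open>y >= 0\<close>, which gives convexity and, on the unit interval, a quadratic upper bound by
  induction instead of calculus.\<close>

lemma power_tangent_remainder_Suc: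
  fixes x y :: real
  shows "x ^ Suc k - y ^ Suc k - Suc k * y ^ (Suc k - 1) * (x - y) =
    x * (x ^ k - y ^ k - k * y ^ (k - 1) * (x - y)) + k * y ^ (k - 1) * (x - y)\<^sup>2"
  by (cases k) (auto simp: algebra_simps power2_eq_square)

lemma power_tangent_remainder_nonneg:
  fixes x y :: real
  assumes "x \<ge> 0" "y \<ge> 0"
  shows "0 \<le> x ^ k - y ^ k - k * y ^ (k - 1) * (x - y)"
proof (induction k)
  case (Suc k)
  then show ?case
    unfolding power_tangent_remainder_Suc using assms
    by (intro add_nonneg_nonneg mult_nonneg_nonneg) auto
qed simp

lemma power_tangent_remainder_le:
  fixes x y :: real
  assumes "x \<in> {0..1}" "y \<in> {0..1}"
  shows "x ^ k - y ^ k - k * y ^ (k - 1) * (x - y) \<le> (real k)\<^sup>2 * (x - y)\<^sup>2"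
proof (induction k)
  case (Suc k)
  have "x * (x ^ k - y ^ k - k * y ^ (k - 1) * (x - y)) \<le> 1 * ((real k)\<^sup>2 * (x - y)\<^sup>2)"
    using assms Suc power_tangent_remainder_nonneg[of x y k] by (intro mult_mono) auto
  moreover have "k * y ^ (k - 1) * (x - y)\<^sup>2 \<le> k * 1 * (x - y)\<^sup>2"
    using assms mult_left_mono[OF power_le_one[of y "k - 1"], of "real k"] by (intro mult_right_mono) auto
  \<comment> \<open>The constant \<open>k ^ 2\<close> is chosen for this step,
    \<open>k ^ 2 + k <= (k + 1) ^ 2\<close>; it is not sharp.\<close>
  moreover have "(real k)\<^sup>2 * (x - y)\<^sup>2 + k * (x - y)\<^sup>2 \<le> (real (Suc k))\<^sup>2 * (x - y)\<^sup>2"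
  proof -
    have "(real k)\<^sup>2 + k \<le> (real (Suc k))\<^sup>2"
      by (simp add: power2_eq_square algebra_simps)
    from mult_right_mono[OF this zero_le_power2, of "x - y"] show ?thesis
      by (simp only: distrib_right)
  qed
  ultimately show ?case
    unfolding power_tangent_remainder_Suc by linarith
qed simp

text \<open>Jensen's inequality: the tangent at the mean lies below the power, and its linear term
  averages to 0.\<close>

lemma expectation_power_ge:
  fixes f :: "'a \<Rightarrow> real"
  assumes fin: "finite (set_pmf M)" and nonneg: "\<And>x. f x \<ge> 0"
  shows "measure_pmf.expectation M f ^ k \<le> measure_pmf.expectation M (\<lambda>x. f x ^ k)"
proof -
  let ?m = "measure_pmf.expectation M f"
  have [simp]: "integrable (measure_pmf M) g" for g :: "'a \<Rightarrow> real"
    using fin by (rule integrable_measure_pmf_finite)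
  have m: "?m \<ge> 0" using nonneg by simp
  have "?m ^ k = measure_pmf.expectation M (\<lambda>x. ?m ^ k + k * ?m ^ (k - 1) * (f x - ?m))"
    by simp
  also have "\<dots> \<le> measure_pmf.expectation M (\<lambda>x. f x ^ k)"
  proof (intro expectation_mono_finite fin)
    show "?m ^ k + k * ?m ^ (k - 1) * (f x - ?m) \<le> f x ^ k" for x
      using power_tangent_remainder_nonneg[OF nonneg m, of x k] by linarith
  qed
  finally show ?thesis .
qed

lemma expectation_edge_degree:
  assumes "p \<in> {0..1}" "i \<in> {1..n}"
  shows "measure_pmf.expectation (bernoulli_prod (possible_edges n) p) (\<lambda>w. real (edge_degree True n w i)) =
    p * real (n - 1)"
  using assms
  by (subst expectation_card_bernoulli_prod) (auto simp: incident_edges_subset card_incident_edges)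

text \<open>Two lower bounds are averaged: \<open>d <= d ^ k\<close> for integers, effective when
  \<open>n p\<close> is small, and Jensen's inequality, effective when it is large. In
  \<open>2 ^ (k + 1)\<close>, the power \<open>2 ^ k\<close> pays for \<open>n - 1 >= n / 2\<close>
  and one factor for the averaging.\<close>

lemma expectation_sum_edge_degree_power_ge:
  assumes p: "p \<in> {0..1}" and k: "k \<ge> 1" and n: "n \<ge> 2"
  shows "n * (n * p * (1 + (n * p) ^ (k - 1))) / 2 ^ (k + 1) \<le>
    measure_pmf.expectation (bernoulli_prod (possible_edges n) p)
      (\<lambda>w. \<Sum>i=1..n. real (edge_degree True n w i) ^ k)"
proof -
  let ?E = "measure_pmf.expectation (bernoulli_prod (possible_edges n) p)"
  let ?d = "\<lambda>w i. real (edge_degree True n w i)"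
  define x where "x = n * p"
  have x: "x \<ge> 0" using p by (simp add: x_def)
  have half: "x / 2 \<le> p * real (n - 1)"
    using mult_left_mono[of "real n" "2 * real (n - 1)" p] n p by (simp add: x_def of_nat_diff mult_ac)
  have "n * (x * (1 + x ^ (k - 1))) / 2 ^ (k + 1) = (\<Sum>i=1..n. (x / 2 ^ k + (x / 2) ^ k) / 2)"
    using k by (simp add: power_divide field_simps flip: power_Suc)
  also have "\<dots> \<le> (\<Sum>i=1..n. ?E (\<lambda>w. ?d w i ^ k))"
  proof (intro sum_mono)
    fix i assume i: "i \<in> {1..n}"
    have le: "real j \<le> real j ^ k" for j :: nat
      using k self_le_power[of "real j" k] by (cases "j = 0") auto
    have "x / 2 ^ k \<le> x / 2"
      using k x power_increasing[of 1 k "2::real"] by (intro divide_left_mono) auto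
    also have "\<dots> \<le> ?E (\<lambda>w. ?d w i)"
      using half unfolding expectation_edge_degree[OF p i] .
    also have "\<dots> \<le> ?E (\<lambda>w. ?d w i ^ k)"
      using le by (intro expectation_mono_finite) auto
    finally have 1: "x / 2 ^ k \<le> ?E (\<lambda>w. ?d w i ^ k)" .
    have "(x / 2) ^ k \<le> ?E (\<lambda>w. ?d w i) ^ k"
      using half x unfolding expectation_edge_degree[OF p i] by (intro power_mono) auto
    also have "\<dots> \<le> ?E (\<lambda>w. ?d w i ^ k)"
      by (intro expectation_power_ge) auto
    finally show "(x / 2 ^ k + (x / 2) ^ k) / 2 \<le> ?E (\<lambda>w. ?d w i ^ k)"
      using 1 by simp
  qed
  also have "\<dots> = ?E (\<lambda>w. \<Sum>i=1..n. ?d w i ^ k)" by simp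
  finally show ?thesis by (simp add: x_def)
qed

text \<open>The mean is compared with \<open>n (x + x ^ k)\<close> and the variance with
  \<open>n x (1 + x ^ (k - 1))\<^sup>2\<close>, where \<open>x = n p\<close>, whether \<open>x\<close> is small or large,
  so the sparse and the dense regime need not be separated.\<close>

lemma relative_variance_sum_edge_degree_power_le:
  fixes k :: nat
  assumes p: "0 < p" "p \<le> 1" and k: "k \<ge> 1" and n: "n \<ge> 2"
  defines "K \<equiv> 2 * (real k)\<^sup>2 * (fact (2 * (k - 1)) * exp 3) * (2 ^ (k - 1) * 2 ^ (k + 1))\<^sup>2"
  shows "measure_pmf.variance (bernoulli_prod (possible_edges n) p)
      (\<lambda>w. \<Sum>i=1..n. real (edge_degree True n w i) ^ k) /
    (measure_pmf.expectation (bernoulli_prod (possible_edges n) p)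
      (\<lambda>w. \<Sum>i=1..n. real (edge_degree True n w i) ^ k))\<^sup>2 \<le> K / ((real n)\<^sup>2 * p)"
proof -
  let ?M = "bernoulli_prod (possible_edges n) p"
  let ?Z = "\<lambda>w. \<Sum>i=1..n. real (edge_degree True n w i) ^ k"
  define x where "x = n * p"
  define y where "y = 1 + x ^ (k - 1)"
  define C :: real where "C = fact (2 * (k - 1)) * exp 3"
  have x: "x > 0" and y: "y > 0" and C: "C > 0"
    using p n by (auto simp: x_def y_def C_def intro!: add_pos_nonneg)
  have "(1 + x) ^ (k - 1) \<le> 2 ^ (k - 1) * y"
  proof -
    \<comment> \<open>Either 1 or \<open>x\<close> dominates in \<open>1 + x\<close>, and both
      resulting powers are summands of \<open>y\<close>.\<close>
    have "(1 + x) ^ (k - 1) \<le> (2 * max 1 x) ^ (k - 1)"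
      using x by (intro power_mono) auto
    also have "\<dots> \<le> 2 ^ (k - 1) * y"
      using x by (auto simp: power_mult_distrib y_def max_def)
    finally show ?thesis .
  qed
  then have sq: "((1 + x) ^ (k - 1))\<^sup>2 \<le> (2 ^ (k - 1) * y)\<^sup>2"
    using x by (intro power_mono) auto
  have "measure_pmf.variance ?M ?Z \<le>
      2 * (real k)\<^sup>2 * (real n)\<^sup>2 * (p * (1 - p)) * (C * (1 + x) ^ (2 * (k - 1)))"
  proof (rule variance_sum_edge_degree_power_le)
    fix i assume i: "i \<in> {1..n}"
    have "measure_pmf.expectation ?M (\<lambda>w. (1 + real (edge_degree True n w i)) ^ (2 * (k - 1))) \<le>
        C * (1 + p * card (incident_edges n i)) ^ (2 * (k - 1))"
      using p moment_card_bernoulli_prod_le[of "possible_edges n" p "incident_edges n i" "2 * (k - 1)"]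
      by (simp add: incident_edges_subset C_def)
    also have "\<dots> \<le> C * (1 + x) ^ (2 * (k - 1))"
      using p C i by (intro mult_left_mono power_mono add_left_mono)
        (auto simp: card_incident_edges x_def mult.commute[of _ p] intro!: mult_left_mono)
    finally show "measure_pmf.expectation ?M (\<lambda>w. (1 + real (edge_degree True n w i)) ^ (2 * (k - 1))) \<le>
        C * (1 + x) ^ (2 * (k - 1))" .
  qed (use p C x in auto)
  also have "\<dots> \<le> 2 * (real k)\<^sup>2 * (real n)\<^sup>2 * (p * 1) * (C * (2 ^ (k - 1) * y)\<^sup>2)"
    using p C sq by (intro mult_mono) (auto simp: power_mult mult.commute[of 2] intro!: mult_left_mono)
  finally have V: "measure_pmf.variance ?M ?Z \<le> 2 * (real k)\<^sup>2 * (real n)\<^sup>2 * p * (C * (2 ^ (k - 1) * y)\<^sup>2)"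
    by simp
  have E: "n * (x * y) / 2 ^ (k + 1) \<le> measure_pmf.expectation ?M ?Z"
    using expectation_sum_edge_degree_power_ge[of p k n] p k n by (simp add: x_def y_def)
  \<comment> \<open>Now \<open>y\<close> cancels, leaving the order
    \<open>n ^ 2 p / (n * n p) ^ 2 = 1 / (n ^ 2 p)\<close> whatever the size of
    \<open>x\<close>.\<close>
  have "measure_pmf.variance ?M ?Z / (measure_pmf.expectation ?M ?Z)\<^sup>2 \<le>
      (2 * (real k)\<^sup>2 * (real n)\<^sup>2 * p * (C * (2 ^ (k - 1) * y)\<^sup>2)) / (n * (x * y) / 2 ^ (k + 1))\<^sup>2"
    using V E x y n p C by (intro frac_le power_mono) auto
  also have "\<dots> = K / ((real n)\<^sup>2 * p)"
  proof -
    have "(a * N\<^sup>2 * p * (C * (P * y)\<^sup>2)) / (N * ((N * p) * y) / Q)\<^sup>2 = a * C * (P * Q)\<^sup>2 / (N\<^sup>2 * p)"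
      if "N > 0" for a N P Q :: real
      using that p y by (simp add: field_simps power2_eq_square)
    then show ?thesis
      using n unfolding x_def K_def C_def by simp
  qed
  finally show ?thesis .
qed

text \<open>The second-order Taylor remainder of \<open>x ^ k\<close> at \<open>x = p\<close> is integrated against
  the law of the normalised degree, whose variance is at most \<open>p * (1 - p) / (n - 1)\<close>.\<close>

lemma expectation_edge_degree_power_near_mean:
  assumes p: "p \<in> {0..1}" and i: "i \<in> {1..n}" and n: "n \<ge> 2"
  shows "measure_pmf.expectation (bernoulli_prod (possible_edges n) p)
      (\<lambda>w. (real (edge_degree True n w i) / real (n - 1)) ^ k) - p ^ k \<in> {0..(real k)\<^sup>2 * (1 - p) / real (n - 1)}"
proof -
  let ?M = "bernoulli_prod (possible_edges n) p"
  let ?E = "measure_pmf.expectation ?M"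
  define s where "s = real (n - 1)"
  let ?x = "\<lambda>w. real (edge_degree True n w i) / s"
  have s: "s > 0" using n by (simp add: s_def)
  have mean: "?E ?x = p"
    using expectation_edge_degree[OF p i] s by (simp add: s_def)
  have var: "?E (\<lambda>w. (?x w - p)\<^sup>2) \<le> p * (1 - p) / s"
  proof -
    have "?x w - p = (real (edge_degree True n w i) - p * s) / s" for w
      using s by (simp add: field_simps)
    then have "?E (\<lambda>w. (?x w - p)\<^sup>2) = ?E (\<lambda>w. (real (edge_degree True n w i) - p * s)\<^sup>2) / s\<^sup>2"
      by (simp add: power_divide)
    also have "\<dots> \<le> p * (1 - p) * s / s\<^sup>2"
      using variance_card_bernoulli_prod_le[OF finite_possible_edges p incident_edges_subset, of n i True]
      unfolding expectation_edge_degree[OF p i] card_incident_edges[OF i] s_def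
      by (rule divide_right_mono) simp
    also have "\<dots> = p * (1 - p) / s"
      using s by (simp add: power2_eq_square)
    finally show ?thesis .
  qed
  have x01: "?x w \<in> {0..1}" for w
    using edge_degree_le[OF i, where c = True and w = w] s by (simp add: s_def field_simps)
  \<comment> \<open>The normalised degree has mean \<open>p\<close>, so the linear term drops out
    and only the remainder is left.\<close>
  have "?E (\<lambda>w. ?x w ^ k - p ^ k - k * p ^ (k - 1) * (?x w - p)) = ?E (\<lambda>w. ?x w ^ k) - p ^ k - k * p ^ (k - 1) * (?E ?x - p)"
    by simp
  then have eq: "?E (\<lambda>w. ?x w ^ k) - p ^ k = ?E (\<lambda>w. ?x w ^ k - p ^ k - k * p ^ (k - 1) * (?x w - p))"
    unfolding mean by simp
  have "0 \<le> ?E (\<lambda>w. ?x w ^ k) - p ^ k"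
    unfolding eq using x01 p by (intro Bochner_Integration.integral_nonneg power_tangent_remainder_nonneg) auto
  moreover have "?E (\<lambda>w. ?x w ^ k) - p ^ k \<le> ?E (\<lambda>w. (real k)\<^sup>2 * (?x w - p)\<^sup>2)"
    unfolding eq using x01 p by (intro expectation_mono_finite power_tangent_remainder_le) auto
  moreover have "?E (\<lambda>w. (real k)\<^sup>2 * (?x w - p)\<^sup>2) \<le> (real k)\<^sup>2 * (p * (1 - p) / s)"
    using mult_left_mono[OF var, of "(real k)\<^sup>2"] by simp
  \<comment> \<open>The factor \<open>1 - p\<close> is retained because the deficit is later divided
    by \<open>1 - p ^ k\<close>.\<close>
  moreover have "(real k)\<^sup>2 * (p * (1 - p) / s) \<le> (real k)\<^sup>2 * (1 * (1 - p) / s)"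
    using p s by (intro mult_left_mono divide_right_mono mult_right_mono) auto
  ultimately show ?thesis by (simp add: s_def)
qed

lemma variance_diff_divide:
  fixes f :: "'a \<Rightarrow> real"
  assumes "finite (set_pmf M)"
  shows "measure_pmf.variance M (\<lambda>x. (c - f x) / d) = measure_pmf.variance M f / d\<^sup>2"
proof -
  have [simp]: "integrable (measure_pmf M) g" for g :: "'a \<Rightarrow> real"
    using assms by (rule integrable_measure_pmf_finite)
  have "(c - f x) / d - measure_pmf.expectation M (\<lambda>x. (c - f x) / d) =
      (measure_pmf.expectation M f - f x) / d" for x
    by (simp add: diff_divide_distrib)
  then show ?thesis
    by (simp add: power_divide power2_commute)
qed

section \<open>Limit theorems for the Zagreb index\<close>

lemma tendsto_in_prob_map_pmf:
  "tendsto_in_prob (\<lambda>n. measure_pmf (map_pmf (g n) (M n))) X c \<longleftrightarrow>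
    tendsto_in_prob (\<lambda>n. measure_pmf (M n)) (\<lambda>n x. X n (g n x)) c"
  by (simp add: tendsto_in_prob_def vimage_def)

lemma tendsto_in_distr_map_pmf:
  "tendsto_in_distr (\<lambda>n. measure_pmf (map_pmf (g n) (M n))) X N \<longleftrightarrow>
    tendsto_in_distr (\<lambda>n. measure_pmf (M n)) (\<lambda>n x. X n (g n x)) N"
proof -
  have "distr (measure_pmf (map_pmf (g n) (M n))) borel (X n) = distr (measure_pmf (M n)) borel (\<lambda>x. X n (g n x))" for n
    unfolding map_pmf_rep_eq by (subst distr_distr) (auto simp: comp_def)
  then show ?thesis by (simp add: tendsto_in_distr_def)
qed

lemma edge_degree_eq_0:
  assumes "card {e \<in> possible_edges n. w e = c} = 0"
  shows "edge_degree c n w i = 0"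
proof -
  have "edge_degree c n w i \<le> card {e \<in> possible_edges n. w e = c}"
    by (intro card_mono) (auto simp: incident_edges_def)
  then show ?thesis using assms by simp
qed

lemma prob_some_edge_le:
  assumes "p \<in> {0..1}"
  shows "measure_pmf.prob (bernoulli_prod (possible_edges n) p) {w. card {e \<in> possible_edges n. w e = c} \<noteq> 0} \<le>
    (real n)\<^sup>2 * (if c then p else 1 - p)"
proof -
  have "real (card (possible_edges n)) \<le> (real n)\<^sup>2"
    by (rule order_trans[OF card_possible_edges_le]) simp
  then have "(if c then p else 1 - p) * card (possible_edges n) \<le> (if c then p else 1 - p) * (real n)\<^sup>2"
    using assms by (intro mult_left_mono) auto
  with prob_card_pos_bernoulli_prod_le[OF finite_possible_edges assms subset_refl, of n c]
  show ?thesis by (simp only: mult.commute)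
qed

text \<open>Here \<open>r\<close> is \<open>p\<close> or \<open>1 - p\<close>. The second limit is
  the Poisson mean; the third kills the probability of adjacent edges, being
  \<open>(n ^ 2 r) ^ 2 / n\<close>.\<close>

lemma edge_count_limits:
  fixes r :: "nat \<Rightarrow> real"
  assumes "(\<lambda>n. (real n)\<^sup>2 * r n) \<longlonglongrightarrow> lam"
  shows "r \<longlonglongrightarrow> 0"
    and "(\<lambda>n. card (possible_edges n) * r n) \<longlonglongrightarrow> lam / 2"
    and "(\<lambda>n. real n ^ 3 * (r n)\<^sup>2) \<longlonglongrightarrow> 0"
proof -
  have inv: "(\<lambda>n. 1 / real n) \<longlonglongrightarrow> 0" by (rule lim_1_over_n)
  have "(\<lambda>n. ((real n)\<^sup>2 * r n) * (1 / real n) * (1 / real n)) \<longlonglongrightarrow> lam * 0 * 0"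
    by (intro tendsto_mult assms inv)
  moreover have "eventually (\<lambda>n. ((real n)\<^sup>2 * r n) * (1 / real n) * (1 / real n) = r n) sequentially"
    using eventually_gt_at_top[of 0] by eventually_elim (simp add: power2_eq_square)
  ultimately show "r \<longlonglongrightarrow> 0"
    using Lim_transform_eventually by fastforce
  have "(\<lambda>n. ((real n)\<^sup>2 * r n) * ((1 - 1 / real n) / 2)) \<longlonglongrightarrow> lam * ((1 - 0) / 2)"
    by (intro tendsto_intros assms inv) auto
  moreover have "eventually (\<lambda>n. ((real n)\<^sup>2 * r n) * ((1 - 1 / real n) / 2) =
      card (possible_edges n) * r n) sequentially"
    unfolding card_possible_edges
    using eventually_gt_at_top[of 0] by eventually_elim (simp add: power2_eq_square field_simps)
  ultimately show "(\<lambda>n. card (possible_edges n) * r n) \<longlonglongrightarrow> lam / 2"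
    using Lim_transform_eventually by fastforce
  have "(\<lambda>n. ((real n)\<^sup>2 * r n)\<^sup>2 * (1 / real n)) \<longlonglongrightarrow> lam\<^sup>2 * 0"
    by (intro tendsto_intros assms inv)
  moreover have "eventually (\<lambda>n. ((real n)\<^sup>2 * r n)\<^sup>2 * (1 / real n) = real n ^ 3 * (r n)\<^sup>2) sequentially"
    using eventually_gt_at_top[of 0]
    by eventually_elim (simp add: power2_eq_square power3_eq_cube field_simps)
  ultimately show "(\<lambda>n. real n ^ 3 * (r n)\<^sup>2) \<longlonglongrightarrow> 0"
    using Lim_transform_eventually by fastforce
qed

text \<open>This is the normalised loss at a vertex whose degree falls from \<open>n - 1\<close> to
  \<open>n - 2\<close>. Factoring the difference of powers gives \<open>k\<close> products of
  \<open>k - 1\<close> factors, each asymptotic to \<open>n\<close>.\<close>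

lemma tendsto_power_diff_quotient:
  assumes "k \<ge> 1"
  shows "(\<lambda>n. ((real n - 1) ^ k - (real n - 2) ^ k) / (real k * real n ^ (k - 1))) \<longlonglongrightarrow> 1"
proof -
  have inv: "(\<lambda>n. 1 / real n) \<longlonglongrightarrow> 0" by (rule lim_1_over_n)
  have "(\<lambda>n. (\<Sum>i<k. (1 - 2 * (1 / real n)) ^ (k - Suc i) * (1 - 1 / real n) ^ i) / real k) \<longlonglongrightarrow>
      (\<Sum>i<k. (1 - 2 * 0) ^ (k - Suc i) * (1 - 0) ^ i) / real k"
    using assms by (intro tendsto_intros inv) auto
  moreover have "eventually (\<lambda>n. (\<Sum>i<k. (1 - 2 * (1 / real n)) ^ (k - Suc i) * (1 - 1 / real n) ^ i) / real k =
      ((real n - 1) ^ k - (real n - 2) ^ k) / (real k * real n ^ (k - 1))) sequentially"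
    using eventually_gt_at_top[of 0]
  proof eventually_elim
    case (elim n)
    have "(real n - 1) ^ k - (real n - 2) ^ k = (\<Sum>i<k. (real n - 2) ^ (k - Suc i) * (real n - 1) ^ i)"
      unfolding power_diff_sumr2 by simp
    also have "\<dots> = (\<Sum>i<k. (1 - 2 * (1 / real n)) ^ (k - Suc i) * (1 - 1 / real n) ^ i * real n ^ (k - 1))"
    proof (intro sum.cong refl)
      fix i assume "i \<in> {..<k}"
      then have "real n ^ (k - 1) = real n ^ (k - Suc i) * real n ^ i"
        by (simp flip: power_add)
      moreover have "real n - 2 = (1 - 2 * (1 / real n)) * real n" "real n - 1 = (1 - 1 / real n) * real n"
        using elim by (auto simp: field_simps)
      ultimately show "(real n - 2) ^ (k - Suc i) * (real n - 1) ^ i =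
          (1 - 2 * (1 / real n)) ^ (k - Suc i) * (1 - 1 / real n) ^ i * real n ^ (k - 1)"
        by (simp only: power_mult_distrib mult_ac)
    qed
    finally show ?case
      using elim assms by (simp flip: sum_distrib_right)
  qed
  ultimately have "(\<lambda>n. ((real n - 1) ^ k - (real n - 2) ^ k) / (real k * real n ^ (k - 1))) \<longlonglongrightarrow>
      (\<Sum>i<k. (1 - 2 * 0) ^ (k - Suc i) * (1 - 0) ^ i) / real k"
    by (rule Lim_transform_eventually)
  then show ?thesis using assms by simp
qed

section \<open>The six asymptotic regimes\<close>

context
  fixes p :: "nat \<Rightarrow> real" and k :: nat
  assumes p: "\<And>n. n \<ge> 1 \<Longrightarrow> 0 < p n \<and> p n < 1"
    and k: "k \<ge> 1"
begin

private abbreviation (input) "M n \<equiv> bernoulli_prod (possible_edges n) (p n)"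

private abbreviation (input) "Z n w \<equiv> \<Sum>i=1..n. real (edge_degree True n w i) ^ k"

private lemma p01: "n \<ge> 1 \<Longrightarrow> p n \<in> {0..1}"
  using p[of n] by simp

text \<open>Nothing is assumed about \<open>p 0\<close>, hence the eventual form here and
  below.\<close>

private lemma p01_eventually: "eventually (\<lambda>n. p n \<in> {0..1}) sequentially"
  using p01 by (intro eventually_sequentiallyI)

private lemma prob_edge_degree_ge_2_tendsto_0:
  fixes c :: bool
  defines "r \<equiv> \<lambda>n. if c then p n else 1 - p n"
  assumes "(\<lambda>n. (real n)\<^sup>2 * r n) \<longlonglongrightarrow> lam"
  shows "(\<lambda>n. measure_pmf.prob (M n) {w. \<exists>i\<in>{1..n}. edge_degree c n w i \<ge> 2}) \<longlonglongrightarrow> 0"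
proof (rule tendsto_sandwich[OF _ _ tendsto_const edge_count_limits(3)[OF assms(2)]])
  show "eventually (\<lambda>n. measure_pmf.prob (M n) {w. \<exists>i\<in>{1..n}. edge_degree c n w i \<ge> 2} \<le>
      real n ^ 3 * (r n)\<^sup>2) sequentially"
    unfolding r_def using p01_eventually by eventually_elim (rule prob_edge_degree_ge_2_le)
qed simp

lemma zagreb_tendsto_0:
  assumes "(\<lambda>n. (real n)\<^sup>2 * p n) \<longlonglongrightarrow> 0"
  shows "tendsto_in_prob (\<lambda>n. measure_pmf (erdos_renyi n (p n))) (zagreb k) 0"
  unfolding erdos_renyi_def tendsto_in_prob_map_pmf zagreb_eq_sum_edge_degree tendsto_in_prob_def
proof (intro allI impI)
  fix \<epsilon> :: real assume \<epsilon>: "\<epsilon> > 0"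
  show "(\<lambda>n. measure_pmf.prob (M n) {w \<in> space (measure_pmf (M n)). \<epsilon> < \<bar>Z n w - 0\<bar>}) \<longlonglongrightarrow> 0"
  proof (rule tendsto_sandwich[OF _ _ tendsto_const assms])
    show "eventually (\<lambda>n. measure_pmf.prob (M n) {w \<in> space (measure_pmf (M n)). \<epsilon> < \<bar>Z n w - 0\<bar>} \<le>
        (real n)\<^sup>2 * p n) sequentially"
      using p01_eventually
    proof eventually_elim
      case (elim n)
      \<comment> \<open>This uses \<open>k >= 1\<close>, since \<open>0 ^ 0 = 1\<close>.\<close>
      have "Z n w = 0" if "card {e \<in> possible_edges n. w e = True} = 0" for w
        using edge_degree_eq_0[OF that] k by (intro sum.neutral) simp
      then have "measure_pmf.prob (M n) {w \<in> space (measure_pmf (M n)). \<epsilon> < \<bar>Z n w - 0\<bar>} \<le>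
          measure_pmf.prob (M n) {w. card {e \<in> possible_edges n. w e = True} \<noteq> 0}"
      proof (intro measure_pmf.finite_measure_mono subsetI CollectI notI)
        fix w assume w: "w \<in> {w \<in> space (measure_pmf (M n)). \<epsilon> < \<bar>Z n w - 0\<bar>}"
          "card {e \<in> possible_edges n. w e = True} = 0"
        from w(1) have "\<epsilon> < \<bar>Z n w - 0\<bar>" by blast
        then show False unfolding \<open>\<And>w. _ \<Longrightarrow> Z n w = 0\<close>[OF w(2)] using \<epsilon> by simp
      qed simp
      also have "\<dots> \<le> (real n)\<^sup>2 * p n"
        using prob_some_edge_le[OF elim, of n True] by simp
      finally show ?case .
    qed
  qed simp
qed

lemma zagreb_complete_prob_tendsto_1:
  assumes "(\<lambda>n. (real n)\<^sup>2 * (1 - p n)) \<longlonglongrightarrow> 0"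
  shows "(\<lambda>n. measure_pmf.prob (erdos_renyi n (p n)) {E. zagreb k n E = real n * (real n - 1) ^ k}) \<longlonglongrightarrow> 1"
proof -
  have "(\<lambda>n. measure_pmf.prob (M n) {w. Z n w = real n * (real n - 1) ^ k}) \<longlonglongrightarrow> 1"
  proof (rule tendsto_sandwich[OF _ _ _ tendsto_const])
    show "(\<lambda>n. 1 - (real n)\<^sup>2 * (1 - p n)) \<longlonglongrightarrow> 1"
      using tendsto_diff[OF tendsto_const[of 1] assms] by simp
    show "eventually (\<lambda>n. 1 - (real n)\<^sup>2 * (1 - p n) \<le>
        measure_pmf.prob (M n) {w. Z n w = real n * (real n - 1) ^ k}) sequentially"
      using p01_eventually eventually_ge_at_top[of 1]
    proof eventually_elim
      case (elim n)
      have "Z n w = real n * (real n - 1) ^ k" if "card {e \<in> possible_edges n. w e = False} = 0" for w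
      proof -
        have "Z n w = (\<Sum>i=1..n. (real n - 1) ^ k)"
          using elim edge_degree_eq_0[OF that]
          by (intro sum.cong refl) (simp only: edge_degree_complement of_nat_diff of_nat_0 diff_0_right of_nat_1)
        then show ?thesis by simp
      qed
      then have "measure_pmf.prob (M n) (- {w. Z n w = real n * (real n - 1) ^ k}) \<le>
          measure_pmf.prob (M n) {w. card {e \<in> possible_edges n. w e = False} \<noteq> 0}"
        by (intro measure_pmf.finite_measure_mono) auto
      also have "\<dots> \<le> (real n)\<^sup>2 * (1 - p n)"
        using prob_some_edge_le[OF elim(1), of n False] by simp
      finally show ?case
        using measure_pmf.prob_compl[of "{w. Z n w = real n * (real n - 1) ^ k}" "M n"]
        by (simp add: Compl_eq_Diff_UNIV)
    qed
  qed (auto intro!: always_eventually)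
  then show ?thesis
    by (simp add: erdos_renyi_def vimage_def zagreb_eq_sum_edge_degree)
qed

lemma zagreb_half_tendsto_Poi:
  assumes "lam > 0" "(\<lambda>n. (real n)\<^sup>2 * p n) \<longlonglongrightarrow> lam"
  shows "tendsto_in_distr (\<lambda>n. measure_pmf (erdos_renyi n (p n))) (\<lambda>n E. zagreb k n E / 2) (Poi (lam / 2))"
  unfolding erdos_renyi_def tendsto_in_distr_map_pmf zagreb_eq_sum_edge_degree
proof (rule tendsto_in_distr_Poi_card[where c = True and a = "\<lambda>_. 1"])
  show "(\<lambda>n. measure_pmf.prob (M n)
      {w. Z n w / 2 \<noteq> 1 * real (card {e \<in> possible_edges n. w e = True})}) \<longlonglongrightarrow> 0"
  proof (rule tendsto_sandwich[OF _ _ tendsto_const])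
    show "(\<lambda>n. measure_pmf.prob (M n) {w. \<exists>i\<in>{1..n}. edge_degree True n w i \<ge> 2}) \<longlonglongrightarrow> 0"
      using prob_edge_degree_ge_2_tendsto_0[of True] assms by simp
    have "Z n w / 2 = real (card {e \<in> possible_edges n. w e = True})"
      if "\<not> (\<exists>i\<in>{1..n}. edge_degree True n w i \<ge> 2)" for n w
    proof -
      have "Z n w = (\<Sum>i=1..n. real (edge_degree True n w i))"
      proof (intro sum.cong refl)
        fix i assume "i \<in> {1..n}"
        with that have "\<not> edge_degree True n w i \<ge> 2" by blast
        then have "edge_degree True n w i = 0 \<or> edge_degree True n w i = 1" by linarith
        moreover have "real d ^ k = real d" if "d = 0 \<or> d = 1" for d
          using that k by auto
        ultimately show "real (edge_degree True n w i) ^ k = real (edge_degree True n w i)"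
          by blast
      qed
      also have "\<dots> = 2 * real (card {e \<in> possible_edges n. w e = True})"
        using arg_cong[OF sum_edge_degree[where c = True and n = n and w = w], of real] by (simp only: of_nat_sum of_nat_mult of_nat_numeral)
      finally show ?thesis by simp
    qed
    then show "eventually (\<lambda>n. measure_pmf.prob (M n) {w. Z n w / 2 \<noteq> 1 * real (card {e \<in> possible_edges n. w e = True})} \<le>
        measure_pmf.prob (M n) {w. \<exists>i\<in>{1..n}. edge_degree True n w i \<ge> 2}) sequentially"
      unfolding mult_1 by (intro always_eventually allI measure_pmf.finite_measure_mono) (blast, simp)
  qed simp
qed (use assms p01_eventually edge_count_limits[OF assms(2)] in auto)

text \<open>When missing edges are pairwise disjoint, every degree is \<open>n - 1\<close> or
  \<open>n - 2\<close>, so the loss at a vertex is linear in its missing degree. By the handshake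
  lemma each missing edge counts twice, which the 2 in the normalisation cancels; the factor left
  over is the \<open>?a n\<close> tending to 1.\<close>

lemma zagreb_deficit_tendsto_Poi:
  assumes "lam > 0" "(\<lambda>n. (real n)\<^sup>2 * (1 - p n)) \<longlonglongrightarrow> lam"
  shows "tendsto_in_distr (\<lambda>n. measure_pmf (erdos_renyi n (p n)))
      (\<lambda>n E. (real n * (real n - 1) ^ k - zagreb k n E) / (2 * real k * real n ^ (k - 1))) (Poi (lam / 2))"
  unfolding erdos_renyi_def tendsto_in_distr_map_pmf zagreb_eq_sum_edge_degree
proof (rule tendsto_in_distr_Poi_card[where c = False])
  let ?a = "\<lambda>n. ((real n - 1) ^ k - (real n - 2) ^ k) / (real k * real n ^ (k - 1))"
  let ?X = "\<lambda>n w. (real n * (real n - 1) ^ k - Z n w) / (2 * real k * real n ^ (k - 1))"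
  show "?a \<longlonglongrightarrow> 1" by (rule tendsto_power_diff_quotient[OF k])
  show "(\<lambda>n. measure_pmf.prob (M n)
      {w. ?X n w \<noteq> ?a n * real (card {e \<in> possible_edges n. w e = False})}) \<longlonglongrightarrow> 0"
  proof (rule tendsto_sandwich[OF _ _ tendsto_const])
    show "(\<lambda>n. measure_pmf.prob (M n) {w. \<exists>i\<in>{1..n}. edge_degree False n w i \<ge> 2}) \<longlonglongrightarrow> 0"
      using prob_edge_degree_ge_2_tendsto_0[of False] assms by simp
    have "?X n w = ?a n * real (card {e \<in> possible_edges n. w e = False})"
      if "\<not> (\<exists>i\<in>{1..n}. edge_degree False n w i \<ge> 2)" "n \<ge> 1" for n w
    proof -
      let ?b = "(real n - 1) ^ k - (real n - 2) ^ k"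
      have "real n * (real n - 1) ^ k - Z n w = (\<Sum>i=1..n. (real n - 1) ^ k - real (edge_degree True n w i) ^ k)"
        by (simp add: sum_subtractf)
      also have "\<dots> = (\<Sum>i=1..n. ?b * real (edge_degree False n w i))"
      proof (intro sum.cong refl)
        fix i assume i: "i \<in> {1..n}"
        with that have "\<not> edge_degree False n w i \<ge> 2" by blast
        then have "edge_degree False n w i = 0 \<or> edge_degree False n w i = 1" by linarith
        have "real (edge_degree True n w i) = real n - 1 - real (edge_degree False n w i)"
          using edge_degree_complement[OF i, of w] that by (simp only: of_nat_diff of_nat_1)
        with \<open>_ \<or> _\<close> show "(real n - 1) ^ k - real (edge_degree True n w i) ^ k = ?b * real (edge_degree False n w i)"
          by (elim disjE) (simp_all only: of_nat_0 of_nat_1 diff_0_right mult_zero_right diff_self mult_1_right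
            diff_diff_eq one_add_one)
      qed
      also have "\<dots> = ?b * (2 * real (card {e \<in> possible_edges n. w e = False}))"
        using arg_cong[OF sum_edge_degree[where c = False and n = n and w = w], of real]
        by (simp only: of_nat_sum of_nat_mult of_nat_numeral flip: sum_distrib_left)
      finally have eq: "real n * (real n - 1) ^ k - Z n w = ?b * (2 * real (card {e \<in> possible_edges n. w e = False}))" .
      have "b * (2 * m) / (2 * real k * N) = b / (real k * N) * m" for b m N :: real
        using k by (cases "N = 0") (auto simp: field_simps)
      then show ?thesis unfolding eq .
    qed
    then show "eventually (\<lambda>n. measure_pmf.prob (M n) {w. ?X n w \<noteq> ?a n * real (card {e \<in> possible_edges n. w e = False})} \<le>
        measure_pmf.prob (M n) {w. \<exists>i\<in>{1..n}. edge_degree False n w i \<ge> 2}) sequentially"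
      by (intro eventually_sequentiallyI[of 1] measure_pmf.finite_measure_mono) (blast, simp)
  qed simp
qed (use assms p01_eventually edge_count_limits[OF assms(2)] in auto)

lemma zagreb_relative_tendsto_1:
  assumes "filterlim (\<lambda>n. (real n)\<^sup>2 * p n) at_top sequentially"
  shows "tendsto_in_prob (\<lambda>n. measure_pmf (erdos_renyi n (p n)))
      (\<lambda>n E. zagreb k n E / measure_pmf.expectation (erdos_renyi n (p n)) (zagreb k n)) 1"
  unfolding erdos_renyi_def tendsto_in_prob_map_pmf integral_map_pmf zagreb_eq_sum_edge_degree
proof (rule tendsto_in_prob_L2)
  let ?EZ = "\<lambda>n. measure_pmf.expectation (M n) (Z n)"
  define K where "K = 2 * (real k)\<^sup>2 * (fact (2 * (k - 1)) * exp 3) * (2 ^ (k - 1) * 2 ^ (k + 1))\<^sup>2"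
  show "(\<lambda>n. measure_pmf.expectation (M n) (\<lambda>w. (Z n w / ?EZ n - 1)\<^sup>2)) \<longlonglongrightarrow> 0"
  proof (rule tendsto_sandwich[OF _ _ tendsto_const])
    show "(\<lambda>n. K / ((real n)\<^sup>2 * p n)) \<longlonglongrightarrow> 0"
      by (intro tendsto_divide_0[OF tendsto_const] filterlim_at_top_imp_at_infinity assms)
    show "eventually (\<lambda>n. measure_pmf.expectation (M n) (\<lambda>w. (Z n w / ?EZ n - 1)\<^sup>2) \<le>
        K / ((real n)\<^sup>2 * p n)) sequentially"
      using eventually_ge_at_top[of 2]
    proof eventually_elim
      case (elim n)
      have pn: "0 < p n" "p n \<le> 1" using p[of n] elim by auto
      \<comment> \<open>Positivity of the mean is needed to rewrite \<open>Z / EZ - 1\<close> as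
        \<open>(Z - EZ) / EZ\<close>.\<close>
      have "0 < n * (n * p n * (1 + (n * p n) ^ (k - 1))) / 2 ^ (k + 1)"
        using elim pn by (auto intro!: divide_pos_pos mult_pos_pos add_pos_nonneg)
      then have "?EZ n > 0"
        using expectation_sum_edge_degree_power_ge[of "p n" k n] pn k elim by simp
      then have "(Z n w / ?EZ n - 1)\<^sup>2 = (Z n w - ?EZ n)\<^sup>2 / (?EZ n)\<^sup>2" for w
        by (simp add: power_divide[symmetric] diff_divide_distrib)
      then have "measure_pmf.expectation (M n) (\<lambda>w. (Z n w / ?EZ n - 1)\<^sup>2) =
          measure_pmf.variance (M n) (Z n) / (?EZ n)\<^sup>2"
        by (simp only: integral_divide_zero)
      also have "\<dots> \<le> K / ((real n)\<^sup>2 * p n)"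
        unfolding K_def using pn k elim by (intro relative_variance_sum_edge_degree_power_le)
      finally show ?case .
    qed
  qed (auto intro!: always_eventually)
qed simp

text \<open>Convexity makes the mean degree power at least that of the mean degree, whence the upper
  bound 1; the Taylor estimate in the other direction gives the lower bound. Neither bound depends
  on \<open>p\<close>.\<close>

lemma expectation_deficit_bounds:
  fixes n :: nat
  defines "X \<equiv> \<lambda>w. (real n * (real n - 1) ^ k - Z n w) / (real n ^ (k + 1) * (1 - p n ^ k))"
  assumes n: "n \<ge> 2"
  shows "(1 - 1 / real n) ^ k * (1 - (real k)\<^sup>2 / (real n - 1)) \<le> measure_pmf.expectation (M n) X"
    and "measure_pmf.expectation (M n) X \<le> 1"
proof -
  define s where "s = real n - 1"
  define D where "D = 1 - p n ^ k"
  have n0: "real n > 0" and s: "s > 0" "s \<le> n" "real (n - 1) = s"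
    using n by (auto simp: s_def of_nat_diff)
  have p': "0 < p n" "p n < 1" "p n \<in> {0..1}" using p[of n] n by auto
  \<comment> \<open>From \<open>p ^ k <= p\<close> the denominator is at least \<open>1 - p\<close>,
    which turns the error \<open>k ^ 2 (1 - p) / s\<close> into the relative error
    \<open>k ^ 2 / s\<close>.\<close>
  have "p n ^ k \<le> p n ^ 1" using p' k by (intro power_decreasing) auto
  then have D: "D \<ge> 1 - p n" "D > 0" using p' by (auto simp: D_def)
  have "measure_pmf.expectation (M n) (\<lambda>w. real (edge_degree True n w i) ^ k) / s ^ k - p n ^ k \<in> {0..(real k)\<^sup>2 * (1 - p n) / s}"
    if "i \<in> {1..n}" for i
    using expectation_edge_degree_power_near_mean[OF p'(3) that n, of k] unfolding s(3) by (simp add: power_divide)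
  then have deg: "measure_pmf.expectation (M n) (\<lambda>w. real (edge_degree True n w i) ^ k) \<in>
      {s ^ k * p n ^ k..s ^ k * (p n ^ k + (real k)\<^sup>2 * (1 - p n) / s)}" if "i \<in> {1..n}" for i
    using that s(1) by (force simp: field_simps)
  have EX: "measure_pmf.expectation (M n) X =
      (n * s ^ k - (\<Sum>i=1..n. measure_pmf.expectation (M n) (\<lambda>w. real (edge_degree True n w i) ^ k))) / (real n ^ (k + 1) * D)"
    unfolding X_def D_def s_def by simp
  have frac: "(1 - 1 / real n) ^ k = s ^ k / real n ^ k"
    using n0 by (simp add: s_def power_divide[symmetric] diff_divide_distrib)
  have "(\<Sum>i=1..n. measure_pmf.expectation (M n) (\<lambda>w. real (edge_degree True n w i) ^ k)) \<ge> (\<Sum>i=1..n. s ^ k * p n ^ k)"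
    using deg by (intro sum_mono) auto
  then have "measure_pmf.expectation (M n) X \<le> (n * s ^ k - n * (s ^ k * p n ^ k)) / (real n ^ (k + 1) * D)"
    unfolding EX using n0 D by (intro divide_right_mono) auto
  also have "\<dots> = n * s ^ k * D / (real n ^ (k + 1) * D)"
    by (simp add: D_def algebra_simps)
  also have "\<dots> = s ^ k / real n ^ k"
    using n0 D by simp
  also have "\<dots> \<le> 1"
    using s n0 by (simp add: power_mono)
  finally show "measure_pmf.expectation (M n) X \<le> 1" .
  have "(\<Sum>i=1..n. measure_pmf.expectation (M n) (\<lambda>w. real (edge_degree True n w i) ^ k)) \<le>
      (\<Sum>i=1..n. s ^ k * (p n ^ k + (real k)\<^sup>2 * (1 - p n) / s))"
    using deg by (intro sum_mono) auto
  then have ge: "(n * s ^ k - n * (s ^ k * (p n ^ k + (real k)\<^sup>2 * (1 - p n) / s))) / (real n ^ (k + 1) * D) \<le>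
      measure_pmf.expectation (M n) X"
    unfolding EX using n0 D by (intro divide_right_mono) auto
  have "(real k)\<^sup>2 * (1 - p n) / s \<le> (real k)\<^sup>2 * D / s"
    using D s by (intro divide_right_mono mult_left_mono) auto
  then have "D * (1 - (real k)\<^sup>2 / s) \<le> D - (real k)\<^sup>2 * (1 - p n) / s"
    by (simp add: algebra_simps)
  then have "s ^ k / real n ^ k * (D * (1 - (real k)\<^sup>2 / s) / D) \<le> s ^ k / real n ^ k * ((D - (real k)\<^sup>2 * (1 - p n) / s) / D)"
    using s n0 D by (intro mult_left_mono divide_right_mono) auto
  also have "\<dots> = n * (s ^ k * (D - (real k)\<^sup>2 * (1 - p n) / s)) / (real n ^ (k + 1) * D)"
    using n0 by simp
  also have "n * (s ^ k * (D - (real k)\<^sup>2 * (1 - p n) / s)) = n * s ^ k - n * (s ^ k * (p n ^ k + (real k)\<^sup>2 * (1 - p n) / s))"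
    by (simp add: D_def algebra_simps)
  finally show "(1 - 1 / real n) ^ k * (1 - (real k)\<^sup>2 / (real n - 1)) \<le> measure_pmf.expectation (M n) X"
    using ge D unfolding frac s_def[symmetric] by simp
qed

text \<open>The crude bound \<open>1 + d <= n\<close> on degrees suffices, because the normalisation
  contains \<open>n ^ (k + 1)\<close> rather than a power of \<open>n p\<close>.\<close>

lemma variance_deficit_le:
  fixes n :: nat
  defines "X \<equiv> \<lambda>w. (real n * (real n - 1) ^ k - Z n w) / (real n ^ (k + 1) * (1 - p n ^ k))"
  assumes n: "n \<ge> 2"
  shows "measure_pmf.variance (M n) X \<le> 2 * (real k)\<^sup>2 / ((real n)\<^sup>2 * (1 - p n))"
proof -
  have n0: "real n > 0" using n by simp
  have p': "0 < p n" "p n < 1" "p n \<in> {0..1}" using p[of n] n by auto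
  have "p n ^ k \<le> p n ^ 1" using p' k by (intro power_decreasing) auto
  then have D: "1 - p n \<le> 1 - p n ^ k" by simp
  have "measure_pmf.variance (M n) (Z n) \<le> 2 * (real k)\<^sup>2 * (real n)\<^sup>2 * (p n * (1 - p n)) * real n ^ (2 * (k - 1))"
  proof (rule variance_sum_edge_degree_power_le)
    fix i assume i: "i \<in> {1..n}"
    have "measure_pmf.expectation (M n) (\<lambda>w. (1 + real (edge_degree True n w i)) ^ (2 * (k - 1))) \<le>
        measure_pmf.expectation (M n) (\<lambda>w. real n ^ (2 * (k - 1)))"
    proof (intro expectation_mono_finite power_mono)
      show "1 + real (edge_degree True n w i) \<le> real n" for w
        using edge_degree_le[OF i, where c = True and w = w] n by linarith
    qed auto
    then show "measure_pmf.expectation (M n) (\<lambda>w. (1 + real (edge_degree True n w i)) ^ (2 * (k - 1))) \<le>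
        real n ^ (2 * (k - 1))" by simp
  qed (use p' in auto)
  also have "\<dots> \<le> 2 * (real k)\<^sup>2 * (real n)\<^sup>2 * (1 * (1 - p n)) * real n ^ (2 * (k - 1))"
    using p' by (intro mult_right_mono mult_left_mono) auto
  finally have V: "measure_pmf.variance (M n) (Z n) \<le> 2 * (real k)\<^sup>2 * (1 - p n) * real n ^ (2 * k)"
    using k by (cases k) (simp_all add: mult_ac power2_eq_square)
  have "measure_pmf.variance (M n) X = measure_pmf.variance (M n) (Z n) / (real n ^ (k + 1) * (1 - p n ^ k))\<^sup>2"
    unfolding X_def by (rule variance_diff_divide) simp
  also have "\<dots> \<le> (2 * (real k)\<^sup>2 * (1 - p n) * real n ^ (2 * k)) / (real n ^ (k + 1) * (1 - p n))\<^sup>2"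
    using V D p' n0 by (intro frac_le power_mono mult_left_mono) auto
  also have "\<dots> = 2 * (real k)\<^sup>2 / ((real n)\<^sup>2 * (1 - p n))"
  proof -
    have "real n ^ (2 * k) = (real n ^ k)\<^sup>2" by (simp add: power_mult mult.commute[of 2])
    moreover have "(a * q * N\<^sup>2) / ((x * N) * q)\<^sup>2 = a / (x\<^sup>2 * q)"
      if "N > 0" "x > 0" "q > 0" for a q N x :: real
      using that by (simp add: field_simps power2_eq_square)
    ultimately show ?thesis using n0 p' by simp
  qed
  finally show ?thesis .
qed

lemma zagreb_deficit_relative_tendsto_1:
  assumes "filterlim (\<lambda>n. (real n)\<^sup>2 * (1 - p n)) at_top sequentially"
  shows "tendsto_in_prob (\<lambda>n. measure_pmf (erdos_renyi n (p n)))
      (\<lambda>n E. (real n * (real n - 1) ^ k - zagreb k n E) / (real n ^ (k + 1) * (1 - p n ^ k))) 1"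
  unfolding erdos_renyi_def tendsto_in_prob_map_pmf zagreb_eq_sum_edge_degree
proof (rule tendsto_in_prob_L2)
  let ?X = "\<lambda>n w. (real n * (real n - 1) ^ k - Z n w) / (real n ^ (k + 1) * (1 - p n ^ k))"
  let ?g = "\<lambda>n. 1 - (1 - 1 / real n) ^ k * (1 - (real k)\<^sup>2 / (real n - 1))"
  show "(\<lambda>n. measure_pmf.expectation (M n) (\<lambda>w. (?X n w - 1)\<^sup>2)) \<longlonglongrightarrow> 0"
  proof (rule tendsto_sandwich[OF _ _ tendsto_const])
    have "(\<lambda>n. 2 * (real k)\<^sup>2 / ((real n)\<^sup>2 * (1 - p n))) \<longlonglongrightarrow> 0"
      by (intro tendsto_divide_0[OF tendsto_const] filterlim_at_top_imp_at_infinity assms)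
    moreover have "(\<lambda>n. (real k)\<^sup>2 / (real n - 1)) \<longlonglongrightarrow> 0"
      by real_asymp
    then have "(\<lambda>n. (?g n)\<^sup>2) \<longlonglongrightarrow> (1 - (1 - 0) ^ k * (1 - 0))\<^sup>2"
      by (intro tendsto_intros lim_1_over_n)
    ultimately show "(\<lambda>n. 2 * (real k)\<^sup>2 / ((real n)\<^sup>2 * (1 - p n)) + (?g n)\<^sup>2) \<longlonglongrightarrow> 0"
      using tendsto_add by fastforce
    show "eventually (\<lambda>n. measure_pmf.expectation (M n) (\<lambda>w. (?X n w - 1)\<^sup>2) \<le>
        2 * (real k)\<^sup>2 / ((real n)\<^sup>2 * (1 - p n)) + (?g n)\<^sup>2) sequentially"
      using eventually_ge_at_top[of 2]
    proof eventually_elim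
      case (elim n)
      note bounds = expectation_deficit_bounds[OF elim]
      \<comment> \<open>The mean is at most 1, so the bias has a known sign and its square is
        bounded by that of \<open>?g n\<close>.\<close>
      have "(measure_pmf.expectation (M n) (?X n) - 1)\<^sup>2 = (1 - measure_pmf.expectation (M n) (?X n))\<^sup>2"
        by (rule power2_commute)
      also have "\<dots> \<le> (?g n)\<^sup>2"
        using bounds by (intro power_mono) linarith+
      finally show ?case
        using variance_deficit_le[OF elim] expectation_square_dist_finite[of "M n" "?X n" 1] by simp
    qed
  qed (auto intro!: always_eventually)
qed simp

end

theorem proposition3:
  fixes p :: "nat \<Rightarrow> real" and k :: nat
  assumes p: "\<And>n. n \<ge> 1 \<Longrightarrow> 0 < p n \<and> p n < 1"
    and k: "k \<ge> 1"
  defines "G \<equiv> \<lambda>n. erdos_renyi n (p n)"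
  shows
    "((\<lambda>n. (real n)\<^sup>2 * p n) \<longlonglongrightarrow> 0 \<longrightarrow>
        tendsto_in_prob (\<lambda>n. measure_pmf (G n)) (zagreb k) 0) \<and>
     (\<forall>lam>0. (\<lambda>n. (real n)\<^sup>2 * p n) \<longlonglongrightarrow> lam \<longrightarrow>
        tendsto_in_distr (\<lambda>n. measure_pmf (G n)) (\<lambda>n E. zagreb k n E / 2) (Poi (lam / 2))) \<and>
     (filterlim (\<lambda>n. (real n)\<^sup>2 * p n) at_top sequentially \<longrightarrow>
        tendsto_in_prob (\<lambda>n. measure_pmf (G n))
          (\<lambda>n E. zagreb k n E / measure_pmf.expectation (G n) (zagreb k n)) 1) \<and>
     ((\<lambda>n. (real n)\<^sup>2 * (1 - p n)) \<longlonglongrightarrow> 0 \<longrightarrow>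
        (\<lambda>n. measure_pmf.prob (G n) {E. zagreb k n E = real n * (real n - 1) ^ k}) \<longlonglongrightarrow> 1) \<and>
     (\<forall>lam>0. (\<lambda>n. (real n)\<^sup>2 * (1 - p n)) \<longlonglongrightarrow> lam \<longrightarrow>
        tendsto_in_distr (\<lambda>n. measure_pmf (G n))
          (\<lambda>n E. (real n * (real n - 1) ^ k - zagreb k n E) / (2 * real k * real n ^ (k - 1)))
          (Poi (lam / 2))) \<and>
     (filterlim (\<lambda>n. (real n)\<^sup>2 * (1 - p n)) at_top sequentially \<longrightarrow>
        tendsto_in_prob (\<lambda>n. measure_pmf (G n))
          (\<lambda>n E. (real n * (real n - 1) ^ k - zagreb k n E) / (real n ^ (k + 1) * (1 - p n ^ k))) 1)"
  unfolding G_def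
  by (intro conjI allI impI zagreb_tendsto_0[OF p k] zagreb_half_tendsto_Poi[OF p k]
      zagreb_relative_tendsto_1[OF p k] zagreb_complete_prob_tendsto_1[OF p k]
      zagreb_deficit_tendsto_Poi[OF p k] zagreb_deficit_relative_tendsto_1[OF p k])

end
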